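(* Let $D$ be a finitely connected, non-degenerate domain with $\infty\in D$ and $0\notin D$. From a name of $D$, the number of boundary components of $D$, a name of $f_D$, and a name of the closed set $\partial C_D$, one can uniformly compute a name of the closed set $\partial D$.
   Context: Computability is in the sense of Type-Two Effectivity. $\hat{\mathbb{C}}=\mathbb{C}\cup\{\infty\}$, and $D_r(z)$ is the open disk of radius $r$ centered at $z$. The basic open sets are the open rectangles whose vertices have rational coordinates, together with the sets $\hat{\mathbb{C}}\setminus\overline{D_r(0)}$ with $r$ rational. Names: - A name of a point $z\in\hat{\mathbb{C}}$ is a list of all basic open sets containing $z$. - A name of an open set $U$ is a list of all basic open sets whose closures lie in $U$. - A name of a closed set $C$ is a list of all basic open sets meeting $C$. - A name of a partial function $f$ is an oracle $X\subseteq\mathbb{N}$ together with a code of an oracle Turing machine with one-way output tape. With oracle $X$, this machine converts every name of every $x\in\mathrm{dom}(f)$ into a name of $f(x)$. - "Uniformly computable from the data" means a single Turing machine with one-way output tape, given names of the data, writes a name of the output. Domains: - A domain is an open connected subset of $\hat{\mathbb{C}}$. - A domain is finitely connected if $\hat{\mathbb{C}}\setminus D$ has finitely many connected components; the boundaries of these components are the boundary components of $D$. - $D$ is non-degenerate if each component of $\hat{\mathbb{C}}\setminus D$ contains at least two points. - A circular domain is a domain whose boundary components are circles. Koebe's theorem: for such $D$, there is a unique circular domain $C_D$ and a unique conformal map $f_D$ of $D$ onto $C_D$ with $f_D(z)=z+O(z^{-1})$ as $z\to\infty$. *)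

theory Defs
  imports "HOL-Complex_Analysis.Complex_Analysis" "HOL-Library.Landau_Symbols" "HOL-Library.Nat_Bijection"
begin

section \<open>The Riemann sphere  C-hat = complex option  (None = infinity)\<close>

definition sphere_open :: "complex option set \<Rightarrow> bool" where
  "sphere_open U \<longleftrightarrow> open {z. Some z \<in> U} \<and>
     (None \<in> U \<longrightarrow> (\<exists>R. \<forall>z. R < norm z \<longrightarrow> Some z \<in> U))"

lemma istopology_sphere_open: "istopology sphere_open"
  unfolding istopology_def
proof (intro conjI allI impI)
  fix S T :: "complex option set"
  assume a1: "sphere_open S" and a2: "sphere_open T"
  note a = conjI[OF a1 a2]
  have "{z. Some z \<in> S \<inter> T} = {z. Some z \<in> S} \<inter> {z. Some z \<in> T}" by auto
  moreover have "None \<in> S \<inter> T \<longrightarrow> (\<exists>R. \<forall>z. R < norm z \<longrightarrow> Some z \<in> S \<inter> T)"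
  proof
    assume "None \<in> S \<inter> T"
    then obtain R1 R2 where "\<forall>z. R1 < norm z \<longrightarrow> Some z \<in> S" "\<forall>z. R2 < norm z \<longrightarrow> Some z \<in> T"
      using a unfolding sphere_open_def by blast
    then show "\<exists>R. \<forall>z. R < norm z \<longrightarrow> Some z \<in> S \<inter> T"
      by (intro exI[of _ "max R1 R2"]) auto
  qed
  ultimately show "sphere_open (S \<inter> T)" using a unfolding sphere_open_def by auto
next
  fix K :: "complex option set set"
  assume a: "\<forall>S\<in>K. sphere_open S"
  have "{z. Some z \<in> \<Union>K} = (\<Union>S\<in>K. {z. Some z \<in> S})" by auto
  moreover have "None \<in> \<Union>K \<longrightarrow> (\<exists>R. \<forall>z. R < norm z \<longrightarrow> Some z \<in> \<Union>K)"
  proof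
    assume "None \<in> \<Union>K"
    then obtain S where S: "S \<in> K" "None \<in> S" by blast
    then obtain R where "\<forall>z. R < norm z \<longrightarrow> Some z \<in> S"
      using a unfolding sphere_open_def by blast
    then show "\<exists>R. \<forall>z. R < norm z \<longrightarrow> Some z \<in> \<Union>K" using S by blast
  qed
  ultimately show "sphere_open (\<Union>K)" using a unfolding sphere_open_def by auto
qed

definition RS :: "complex option topology" where
  "RS = topology sphere_open"

lemma openin_RS: "openin RS U \<longleftrightarrow> sphere_open U"
  unfolding RS_def using istopology_sphere_open by (simp add: topology_inverse')

definition domain_RS :: "complex option set \<Rightarrow> bool" where
  "domain_RS D \<longleftrightarrow> openin RS D \<and> connectedin RS D \<and> D \<noteq> {}"

definition compl_components :: "complex option set \<Rightarrow> complex option set set" where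
  "compl_components D = connected_components_of (subtopology RS (UNIV - D))"

definition boundary_components :: "complex option set \<Rightarrow> complex option set set" where
  "boundary_components D = (\<lambda>K. RS frontier_of K) ` compl_components D"

definition finitely_connected :: "complex option set \<Rightarrow> bool" where
  "finitely_connected D \<longleftrightarrow> domain_RS D \<and> finite (compl_components D)"

definition non_degenerate :: "complex option set \<Rightarrow> bool" where
  "non_degenerate D \<longleftrightarrow> (\<forall>K\<in>compl_components D. \<exists>a b. a \<in> K \<and> b \<in> K \<and> a \<noteq> b)"

definition is_circle :: "complex option set \<Rightarrow> bool" where
  "is_circle S \<longleftrightarrow> (\<exists>c r. r > 0 \<and> S = Some ` sphere c r)"

definition circular_domain :: "complex option set \<Rightarrow> bool" where
  "circular_domain C \<longleftrightarrow> domain_RS C \<and> (\<forall>B\<in>boundary_components C. is_circle B)"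

definition koebe_normalized_conformal ::
  "(complex option \<Rightarrow> complex option) \<Rightarrow> complex option set \<Rightarrow> complex option set \<Rightarrow> bool" where
  "koebe_normalized_conformal f D C \<longleftrightarrow>
     bij_betw f D C \<and> f None = None \<and>
     (\<lambda>z. the (f (Some z))) holomorphic_on {z. Some z \<in> D} \<and>
     (\<lambda>z. the (f (Some z)) - z) \<in> O[at_infinity](\<lambda>z. inverse z)"

definition rat_code :: "nat \<Rightarrow> real" where
  "rat_code n = (case prod_decode n of (a, b) \<Rightarrow> real_of_int (int_decode a) / real (b + 1))"

definition rect_params :: "nat \<Rightarrow> real \<times> real \<times> real \<times> real" where
  "rect_params m = (case prod_decode m of (i, j) \<Rightarrow> (case prod_decode i of (a, b) \<Rightarrow>
      (case prod_decode j of (c, d) \<Rightarrow> (rat_code a, rat_code b, rat_code c, rat_code d))))"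

definition valid_code :: "nat \<Rightarrow> bool" where
  "valid_code n \<longleftrightarrow> (if even n then
      (case rect_params (n div 2) of (a, b, c, d) \<Rightarrow> a < b \<and> c < d)
    else 0 < rat_code (n div 2))"

definition basic :: "nat \<Rightarrow> complex option set" where
  "basic n = (if even n then
      (case rect_params (n div 2) of (a, b, c, d) \<Rightarrow>
         Some ` {z. a < Re z \<and> Re z < b \<and> c < Im z \<and> Im z < d})
    else insert None (Some ` {z. rat_code (n div 2) < norm z}))"

text \<open>A stream p lists the set of codes {n. \<exists>k. p k = n + 1} (value 0 = padding).\<close>
definition listed :: "(nat \<Rightarrow> nat) \<Rightarrow> nat set" where
  "listed p = {n. \<exists>k. p k = Suc n}"

definition point_name :: "(nat \<Rightarrow> nat) \<Rightarrow> complex option \<Rightarrow> bool" where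
  "point_name p z \<longleftrightarrow> listed p = {n. valid_code n \<and> z \<in> basic n}"

definition open_name :: "(nat \<Rightarrow> nat) \<Rightarrow> complex option set \<Rightarrow> bool" where
  "open_name p U \<longleftrightarrow> listed p = {n. valid_code n \<and> RS closure_of (basic n) \<subseteq> U}"

definition closed_name :: "(nat \<Rightarrow> nat) \<Rightarrow> complex option set \<Rightarrow> bool" where
  "closed_name p A \<longleftrightarrow> listed p = {n. valid_code n \<and> basic n \<inter> A \<noteq> {}}"

datatype recf = Zf | Sf | Proj nat | Orc | Comp recf "recf list" | Prim recf recf | Mn recf

inductive eval :: "(nat \<Rightarrow> nat) \<Rightarrow> recf \<Rightarrow> nat list \<Rightarrow> nat \<Rightarrow> bool" for \<alpha> where
  eval_Z: "eval \<alpha> Zf xs 0"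
| eval_S: "eval \<alpha> Sf (x # xs) (Suc x)"
| eval_Proj: "i < length xs \<Longrightarrow> eval \<alpha> (Proj i) xs (xs ! i)"
| eval_Orc: "eval \<alpha> Orc (x # xs) (\<alpha> x)"
| eval_Comp: "length ys = length gs \<Longrightarrow> (\<forall>i<length gs. eval \<alpha> (gs ! i) xs (ys ! i)) \<Longrightarrow>
     eval \<alpha> f ys z \<Longrightarrow> eval \<alpha> (Comp f gs) xs z"
| eval_Prim0: "eval \<alpha> f xs y \<Longrightarrow> eval \<alpha> (Prim f g) (0 # xs) y"
| eval_PrimS: "eval \<alpha> (Prim f g) (n # xs) y \<Longrightarrow> eval \<alpha> g (n # y # xs) z \<Longrightarrow>
     eval \<alpha> (Prim f g) (Suc n # xs) z"
| eval_Mn: "eval \<alpha> f (n # xs) 0 \<Longrightarrow> (\<forall>m<n. \<exists>y. 0 < y \<and> eval \<alpha> f (m # xs) y) \<Longrightarrow>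
     eval \<alpha> (Mn f) xs n"

text \<open>Machine M with oracle/input stream \<alpha> writes the infinite output stream \<beta>
  (equivalent to an oracle Turing machine with one-way output tape).\<close>
definition computes :: "(nat \<Rightarrow> nat) \<Rightarrow> recf \<Rightarrow> (nat \<Rightarrow> nat) \<Rightarrow> bool" where
  "computes \<alpha> M \<beta> \<longleftrightarrow> (\<forall>k. eval \<alpha> M [k] (\<beta> k))"

fun code :: "recf \<Rightarrow> nat" where
  "code Zf = prod_encode (0, 0)"
| "code Sf = prod_encode (1, 0)"
| "code (Proj i) = prod_encode (2, i)"
| "code Orc = prod_encode (3, 0)"
| "code (Comp f gs) = prod_encode (4, prod_encode (code f, list_encode (map code gs)))"
| "code (Prim f g) = prod_encode (5, prod_encode (code f, code g))"
| "code (Mn f) = prod_encode (6, code f)"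

definition char_stream :: "nat set \<Rightarrow> nat \<Rightarrow> nat" where
  "char_stream X k = (if k \<in> X then 1 else 0)"

definition fun_name :: "nat set \<Rightarrow> recf \<Rightarrow> complex option set \<Rightarrow>
    (complex option \<Rightarrow> complex option) \<Rightarrow> bool" where
  "fun_name X M Dm f \<longleftrightarrow> (\<forall>x\<in>Dm. \<forall>p. point_name p x \<longrightarrow>
     (\<exists>\<beta>. computes (\<lambda>k. if even k then char_stream X (k div 2) else p (k div 2)) M \<beta>
          \<and> point_name \<beta> (f x)))"

text \<open>Combined input tape for the uniform machine: (n, code M, X, name of D, name of \<partial>C_D).\<close>
definition input5 :: "nat \<Rightarrow> nat \<Rightarrow> nat set \<Rightarrow> (nat \<Rightarrow> nat) \<Rightarrow> (nat \<Rightarrow> nat) \<Rightarrow> nat \<Rightarrow> nat" where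
  "input5 n e X p q k = (case k mod 5 of 0 \<Rightarrow> n | Suc 0 \<Rightarrow> e
      | Suc (Suc 0) \<Rightarrow> char_stream X (k div 5)
      | Suc (Suc (Suc 0)) \<Rightarrow> p (k div 5) | _ \<Rightarrow> q (k div 5))"

end

theory Submission
  imports Defs
begin

text \<open>Write \<open>g\<close> for the conformal map on the finite part of \<open>D\<close>. If a disk \<open>ball z s\<close> lies in \<open>D\<close> and
  \<open>a\<close> is a boundary point of \<open>C\<close>, then Schottky's theorem, applied to a square root of \<open>a - g\<close>, gives
  \<open>norm (g w - g z) \<le> N * norm (a - g z)\<close> for \<open>norm (w - z) < s / 2\<close> with an absolute constant \<open>N\<close>.
  A violation of this inequality at rational points therefore certifies that \<open>ball z s\<close> meets the boundary
  of \<open>D\<close>, and it can be recognised from finitely much of the given names.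
  Conversely every basic open set meeting the boundary of \<open>D\<close> has such a certificate: as \<open>z\<close> tends to a boundary
  point of \<open>D\<close> the values \<open>g z\<close> accumulate at a boundary point of \<open>C\<close>, while \<open>g w\<close> stays away from it for
  fixed \<open>w\<close>. Hence the basic open sets meeting the boundary of \<open>D\<close> are uniformly
  semidecidable, the values of \<open>g\<close> being obtained by a universal machine.\<close>

section \<open>Computability relative to an oracle\<close>

text \<open>No finite part of a name of \<open>D\<close> reveals directly that a set touches the
  boundary, since it lists only sets inside \<open>D\<close>. A certificate therefore refutes an
  inclusion: it exhibits a disk on which \<open>g\<close> moves more than a univalent function
  omitting a nearby value can, and connectedness then supplies a boundary point. It rests on strict
  inequalities between rationals and finitely many tape entries. The constant in the estimate must
  not depend on \<open>D\<close>, \<open>f\<close> or \<open>C\<close>, because it is built into the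
  machine; its mere existence is enough. The map arrives as a program code, and a program run
  outside its domain need not halt. The closure properties are nevertheless developed for total
  functionals only: each search that may fail is moved into the existential quantifier of
  \<open>semidecidable\<close>, and a halting computation is recognised by guessing a finite list of
  verdicts that justify one another. The resulting predicate is turned back into a total output
  stream by running through all pairs of a candidate and a witness.\<close>

definition computable_on :: "nat \<Rightarrow> ((nat \<Rightarrow> nat) \<Rightarrow> nat list \<Rightarrow> nat) \<Rightarrow> bool" where
  "computable_on k F \<longleftrightarrow> (\<exists>M. \<forall>\<alpha> xs. length xs = k \<longrightarrow> eval \<alpha> M xs (F \<alpha> xs))"

lemma computable_on_cong:
  assumes "computable_on k F" "\<And>\<alpha> xs. length xs = k \<Longrightarrow> F \<alpha> xs = G \<alpha> xs"
  shows "computable_on k G"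
  using assms unfolding computable_on_def by metis

lemma computable_on_nth: "i < k \<Longrightarrow> computable_on k (\<lambda>\<alpha> xs. xs ! i)"
  unfolding computable_on_def by (metis eval_Proj)

lemma computable_on_comp:
  assumes "computable_on (length Fs) H" "\<forall>F\<in>set Fs. computable_on k F"
  shows "computable_on k (\<lambda>\<alpha> xs. H \<alpha> (map (\<lambda>F. F \<alpha> xs) Fs))"
proof -
  obtain M where M: "\<And>\<alpha> xs. length xs = length Fs \<Longrightarrow> eval \<alpha> M xs (H \<alpha> xs)"
    using assms(1) unfolding computable_on_def by blast
  have "\<forall>F\<in>set Fs. \<exists>N. \<forall>\<alpha> xs. length xs = k \<longrightarrow> eval \<alpha> N xs (F \<alpha> xs)"
    using assms(2) unfolding computable_on_def by blast
  then obtain N where N: "\<And>F \<alpha> xs. F \<in> set Fs \<Longrightarrow> length xs = k \<Longrightarrow> eval \<alpha> (N F) xs (F \<alpha> xs)"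
    by metis
  have "eval \<alpha> (Comp M (map N Fs)) xs (H \<alpha> (map (\<lambda>F. F \<alpha> xs) Fs))" if "length xs = k" for \<alpha> xs
    by (rule eval_Comp[where ys = "map (\<lambda>F. F \<alpha> xs) Fs"]) (auto simp: that N M)
  then show ?thesis unfolding computable_on_def by blast
qed

lemma computable_on_comp1:
  assumes "computable_on 1 H" "computable_on k F"
  shows "computable_on k (\<lambda>\<alpha> xs. H \<alpha> [F \<alpha> xs])"
  using computable_on_comp[of "[F]" H k] assms by simp

lemma computable_on_comp2:
  assumes "computable_on 2 H" "computable_on k F" "computable_on k G"
  shows "computable_on k (\<lambda>\<alpha> xs. H \<alpha> [F \<alpha> xs, G \<alpha> xs])"
  using computable_on_comp[of "[F, G]" H k] assms by (simp add: numeral_2_eq_2)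

lemma computable_on_Suc:
  assumes "computable_on k F"
  shows "computable_on k (\<lambda>\<alpha> xs. Suc (F \<alpha> xs))"
proof -
  have "computable_on 1 (\<lambda>\<alpha> xs. Suc (xs ! 0))"
    unfolding computable_on_def
    by (rule exI[of _ Sf]) (auto simp: length_Suc_conv intro: eval_S)
  from computable_on_comp1[OF this assms] show ?thesis by simp
qed

lemma computable_on_oracle:
  assumes "computable_on k F"
  shows "computable_on k (\<lambda>\<alpha> xs. \<alpha> (F \<alpha> xs))"
proof -
  have "computable_on 1 (\<lambda>\<alpha> xs. \<alpha> (xs ! 0))"
    unfolding computable_on_def
    by (rule exI[of _ Orc]) (auto simp: length_Suc_conv intro: eval_Orc)
  from computable_on_comp1[OF this assms] show ?thesis by simp
qed

lemma computable_on_const: "computable_on k (\<lambda>\<alpha> xs. c)"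
proof (induction c)
  case 0
  show ?case unfolding computable_on_def by (metis eval_Z)
next
  case (Suc c)
  then show ?case by (rule computable_on_Suc)
qed

lemma computable_on_rec:
  assumes "computable_on k F" "computable_on (Suc (Suc k)) G"
  shows "computable_on (Suc k) (\<lambda>\<alpha> xs. rec_nat (F \<alpha> (tl xs)) (\<lambda>n y. G \<alpha> (n # y # tl xs)) (hd xs))"
proof -
  obtain M where M: "\<And>\<alpha> xs. length xs = k \<Longrightarrow> eval \<alpha> M xs (F \<alpha> xs)"
    using assms(1) unfolding computable_on_def by blast
  obtain N where N: "\<And>\<alpha> xs. length xs = Suc (Suc k) \<Longrightarrow> eval \<alpha> N xs (G \<alpha> xs)"
    using assms(2) unfolding computable_on_def by blast
  have "eval \<alpha> (Prim M N) (n # ys) (rec_nat (F \<alpha> ys) (\<lambda>n y. G \<alpha> (n # y # ys)) n)"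
    if "length ys = k" for \<alpha> n ys
    by (induction n) (auto intro!: eval_Prim0 eval_PrimS M N simp: that)
  then show ?thesis unfolding computable_on_def
    by (intro exI[of _ "Prim M N"]) (auto simp: length_Suc_conv)
qed

lemma computable_on_Least:
  assumes "computable_on (Suc k) F" "\<And>\<alpha> xs. length xs = k \<Longrightarrow> \<exists>n. F \<alpha> (n # xs) = 0"
  shows "computable_on k (\<lambda>\<alpha> xs. LEAST n. F \<alpha> (n # xs) = 0)"
proof -
  obtain M where M: "\<And>\<alpha> xs. length xs = Suc k \<Longrightarrow> eval \<alpha> M xs (F \<alpha> xs)"
    using assms(1) unfolding computable_on_def by blast
  have "eval \<alpha> (Mn M) xs (LEAST n. F \<alpha> (n # xs) = 0)" if l: "length xs = k" for \<alpha> xs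
  proof (rule eval_Mn)
    have "F \<alpha> ((LEAST n. F \<alpha> (n # xs) = 0) # xs) = 0"
      using LeastI_ex[OF assms(2)[OF l]] .
    then show "eval \<alpha> M ((LEAST n. F \<alpha> (n # xs) = 0) # xs) 0"
      using M[of "(LEAST n. F \<alpha> (n # xs) = 0) # xs" \<alpha>] l by simp
    show "\<forall>m<LEAST n. F \<alpha> (n # xs) = 0. \<exists>y>0. eval \<alpha> M (m # xs) y"
    proof (intro allI impI)
      fix m assume "m < (LEAST n. F \<alpha> (n # xs) = 0)"
      then have "0 < F \<alpha> (m # xs)" using not_less_Least by blast
      then show "\<exists>y>0. eval \<alpha> M (m # xs) y" using M[of "m # xs" \<alpha>] l by auto
    qed
  qed
  then show ?thesis unfolding computable_on_def by blast
qed

section \<open>Elementary arithmetic by primitive recursion\<close>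

lemma computable_on_add:
  assumes "computable_on k F" "computable_on k G"
  shows "computable_on k (\<lambda>\<alpha> xs. F \<alpha> xs + G \<alpha> xs)"
proof -
  have "computable_on (Suc 1) (\<lambda>\<alpha> xs. rec_nat (tl xs ! 0) (\<lambda>n y. Suc ((n # y # tl xs) ! 1)) (hd xs))"
    by (intro computable_on_rec[where F = "\<lambda>\<alpha> ys. ys ! 0" and G = "\<lambda>\<alpha> ys. Suc (ys ! 1)"]
        computable_on_Suc computable_on_nth) auto
  moreover have "rec_nat y (\<lambda>n y. Suc y) x = x + y" for x y :: nat by (induction x) auto
  ultimately show ?thesis
    using computable_on_comp2[of "\<lambda>\<alpha> xs. rec_nat (tl xs ! 0) (\<lambda>n y. Suc ((n # y # tl xs) ! 1)) (hd xs)" k F G] assms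
    by (simp add: numeral_2_eq_2)
qed

lemma computable_on_diff:
  assumes "computable_on k F" "computable_on k G"
  shows "computable_on k (\<lambda>\<alpha> xs. F \<alpha> xs - G \<alpha> xs)"
proof -
  have pred: "computable_on (Suc 0) (\<lambda>\<alpha> xs. (xs ! 0) - 1)"
  proof (rule computable_on_cong)
    show "computable_on (Suc 0) (\<lambda>\<alpha> xs. rec_nat 0 (\<lambda>n y. (n # y # tl xs) ! 0) (hd xs))"
      by (intro computable_on_rec[where F = "\<lambda>\<alpha> ys. 0" and G = "\<lambda>\<alpha> ys. ys ! 0"]
        computable_on_const computable_on_nth) auto
    show "rec_nat 0 (\<lambda>n y. (n # y # tl xs) ! 0) (hd xs) = xs ! 0 - 1" if "length xs = Suc 0" for xs :: "nat list"
      using that by (cases xs; cases "hd xs") auto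
  qed
  \<comment> \<open>The recursion runs on the first argument and steps down from the second, so it
    yields second minus first; \<open>G\<close> and \<open>F\<close> are supplied in that order
    below.\<close>
  have "computable_on (Suc 1) (\<lambda>\<alpha> xs. rec_nat (tl xs ! 0) (\<lambda>n y. ((n # y # tl xs) ! 1) - 1) (hd xs))"
    using computable_on_comp1[OF pred[folded One_nat_def] computable_on_nth[of 1 "Suc (Suc 1)"]]
    by (intro computable_on_rec[where F = "\<lambda>\<alpha> ys. ys ! 0" and G = "\<lambda>\<alpha> ys. ys ! 1 - 1"] 
        computable_on_nth) auto
  moreover have "rec_nat y (\<lambda>n y. y - Suc 0) x = y - x" for x y :: nat by (induction x) auto
  ultimately show ?thesis
    using computable_on_comp2[of "\<lambda>\<alpha> xs. rec_nat (tl xs ! 0) (\<lambda>n y. ((n # y # tl xs) ! 1) - 1) (hd xs)" k G F] assms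
    by (simp add: numeral_2_eq_2)
qed

lemma computable_on_triangle:
  assumes "computable_on k F"
  shows "computable_on k (\<lambda>\<alpha> xs. triangle (F \<alpha> xs))"
proof -
  have "computable_on (Suc 0) (\<lambda>\<alpha> xs. rec_nat 0 (\<lambda>n y. (n # y # tl xs) ! 1 + Suc ((n # y # tl xs) ! 0)) (hd xs))"
    by (intro computable_on_rec[where F = "\<lambda>\<alpha> ys. 0" and G = "\<lambda>\<alpha> ys. ys ! 1 + Suc (ys ! 0)"]
        computable_on_const computable_on_nth computable_on_add computable_on_Suc) auto
  moreover have "rec_nat 0 (\<lambda>n y. Suc (y + n)) x = triangle x" for x :: nat by (induction x) auto
  ultimately show ?thesis
    using computable_on_comp1[of "\<lambda>\<alpha> xs. rec_nat 0 (\<lambda>n y. (n # y # tl xs) ! 1 + Suc ((n # y # tl xs) ! 0)) (hd xs)" k F] assms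
    by simp
qed

section \<open>Coding of pairs\<close>

abbreviation pair :: "nat \<Rightarrow> nat \<Rightarrow> nat" where "pair x y \<equiv> prod_encode (x, y)"
definition pfst :: "nat \<Rightarrow> nat" where "pfst u = fst (prod_decode u)"
definition psnd :: "nat \<Rightarrow> nat" where "psnd u = snd (prod_decode u)"

lemma pfst_pair [simp]: "pfst (pair x y) = x" and psnd_pair [simp]: "psnd (pair x y) = y"
  and pair_pfst_psnd [simp]: "pair (pfst u) (psnd u) = u"
  by (simp_all add: pfst_def psnd_def)

lemma ex_pair_iff: "(\<exists>u. P u) \<longleftrightarrow> (\<exists>x y. P (pair x y))"
  using pair_pfst_psnd by metis

text \<open>The diagonal of a pair code is found by unbounded search, since no coding of pairs
  is available yet to carry a pair through a primitive recursion.\<close>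
lemma diagonal_eq_Least: "pfst u + psnd u = (LEAST s. Suc u - triangle (Suc s) = 0)"
proof (rule sym, rule Least_equality)
  have u: "u = triangle (pfst u + psnd u) + pfst u"
    using pair_pfst_psnd[of u] unfolding prod_encode_def by simp
  show "Suc u - triangle (Suc (pfst u + psnd u)) = 0"
    by (subst u) simp
  fix s assume "Suc u - triangle (Suc s) = 0"
  then have *: "u < triangle (Suc s)" by simp
  have mono: "triangle a \<le> triangle b" if "a \<le> b" for a b
    using that by (rule lift_Suc_mono_le[rotated]) simp
  show "pfst u + psnd u \<le> s"
  proof (rule ccontr)
    assume "\<not> ?thesis"
    then have "triangle (Suc s) \<le> triangle (pfst u + psnd u)" by (intro mono) simp
    with * u show False by linarith
  qed
qed

lemma computable_on_pair:
  assumes "computable_on k F" "computable_on k G"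
  shows "computable_on k (\<lambda>\<alpha> xs. pair (F \<alpha> xs) (G \<alpha> xs))"
  unfolding prod_encode_def prod.case using assms
  by (intro computable_on_add computable_on_triangle)

lemma computable_on_pfst_psnd:
  assumes F: "computable_on k F"
  shows "computable_on k (\<lambda>\<alpha> xs. pfst (F \<alpha> xs))" "computable_on k (\<lambda>\<alpha> xs. psnd (F \<alpha> xs))"
proof -
  define d where "d u = pfst u + psnd u" for u
  \<comment> \<open>Under truncated subtraction the test vanishes iff
    \<open>u < triangle (Suc s)\<close>. It always succeeds at \<open>s = u\<close>, so the search
    is total.\<close>
  have "computable_on 1 (\<lambda>\<alpha> xs. LEAST s. Suc ((s # xs) ! 1) - triangle (Suc ((s # xs) ! 0)) = 0)"
  proof (rule computable_on_Least[where F = "\<lambda>\<alpha> xs. Suc (xs ! 1) - triangle (Suc (xs ! 0))"])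
    show "computable_on (Suc 1) (\<lambda>\<alpha> xs. Suc (xs ! 1) - triangle (Suc (xs ! 0)))"
      by (intro computable_on_diff computable_on_Suc computable_on_triangle computable_on_nth) auto
    show "\<exists>n. Suc ((n # xs) ! 1) - triangle (Suc ((n # xs) ! 0)) = 0" for xs
      by (rule exI[of _ "xs ! 0"]) simp
  qed
  from computable_on_comp1[OF this F] have d: "computable_on k (\<lambda>\<alpha> xs. d (F \<alpha> xs))"
    by (simp add: d_def diagonal_eq_Least)
  have 1: "pfst u = u - triangle (d u)" for u
    using pair_pfst_psnd[of u] unfolding prod_encode_def d_def by simp
  have "computable_on k (\<lambda>\<alpha> xs. F \<alpha> xs - triangle (d (F \<alpha> xs)))"
    by (intro computable_on_diff computable_on_triangle d F)
  then show *: "computable_on k (\<lambda>\<alpha> xs. pfst (F \<alpha> xs))" by (simp add: 1)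
  have "computable_on k (\<lambda>\<alpha> xs. d (F \<alpha> xs) - pfst (F \<alpha> xs))"
    by (intro computable_on_diff d *)
  then show "computable_on k (\<lambda>\<alpha> xs. psnd (F \<alpha> xs))" by (simp add: d_def)
qed

text \<open>From here on functions are unary and further arguments are passed as pair codes, so that a
  computability goal is a closed term over a single argument.\<close>
definition computable :: "((nat \<Rightarrow> nat) \<Rightarrow> nat \<Rightarrow> nat) \<Rightarrow> bool" where
  "computable F \<longleftrightarrow> computable_on 1 (\<lambda>\<alpha> xs. F \<alpha> (xs ! 0))"

lemma computable_iff_recf: "computable F \<longleftrightarrow> (\<exists>M. \<forall>\<alpha> x. eval \<alpha> M [x] (F \<alpha> x))"
  unfolding computable_def computable_on_def
  by (rule ex_cong1) (force simp: length_Suc_conv)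

named_theorems computable_intros

lemma computable_id [computable_intros]: "computable (\<lambda>\<alpha> x. x)"
  unfolding computable_def by (intro computable_on_nth) simp

lemma computable_const [computable_intros]: "computable (\<lambda>\<alpha> x. c)"
  unfolding computable_def by (rule computable_on_const)

lemma computable_comp:
  assumes "computable G" "computable F" shows "computable (\<lambda>\<alpha> x. G \<alpha> (F \<alpha> x))"
  using computable_on_comp1[OF assms[unfolded computable_def]] unfolding computable_def by simp

lemma computable_basic [computable_intros]:
  assumes "computable F"
  shows "computable (\<lambda>\<alpha> x. Suc (F \<alpha> x))" "computable (\<lambda>\<alpha> x. \<alpha> (F \<alpha> x))"
    "computable (\<lambda>\<alpha> x. pfst (F \<alpha> x))" "computable (\<lambda>\<alpha> x. psnd (F \<alpha> x))"
  using assms unfolding computable_def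
  by (simp_all add: computable_on_Suc computable_on_oracle computable_on_pfst_psnd)

lemma computable_basic2 [computable_intros]:
  assumes "computable F" "computable G"
  shows "computable (\<lambda>\<alpha> x. pair (F \<alpha> x) (G \<alpha> x))" "computable (\<lambda>\<alpha> x. F \<alpha> x + G \<alpha> x)"
    "computable (\<lambda>\<alpha> x. F \<alpha> x - G \<alpha> x)"
  using assms unfolding computable_def
  by (simp_all add: computable_on_pair computable_on_add computable_on_diff)

lemma computable_comp2:
  assumes "computable (\<lambda>\<alpha> u. H \<alpha> (pfst u) (psnd u))" "computable F" "computable G"
  shows "computable (\<lambda>\<alpha> x. H \<alpha> (F \<alpha> x) (G \<alpha> x))"
  using computable_comp[OF assms(1) computable_basic2(1)[OF assms(2,3)]] by simp

lemma computable_rec: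
  assumes "computable F" "computable (\<lambda>\<alpha> u. G \<alpha> (pfst u) (pfst (psnd u)) (psnd (psnd u)))"
    and "computable N"
  shows "computable (\<lambda>\<alpha> x. rec_nat (F \<alpha> x) (\<lambda>n y. G \<alpha> x n y) (N \<alpha> x))"
proof -
  let ?H = "\<lambda>\<alpha> xs. rec_nat (F \<alpha> (tl xs ! 0))
    (\<lambda>n y. G \<alpha> ((n # y # tl xs) ! 2) ((n # y # tl xs) ! 0) ((n # y # tl xs) ! 1)) (hd xs)"
  have "computable_on (Suc (Suc 1)) (\<lambda>\<alpha> xs. pair (xs ! 2) (pair (xs ! 0) (xs ! 1)))"
    by (intro computable_on_pair computable_on_nth) auto
  from computable_on_comp1[OF assms(2)[unfolded computable_def] this]
  have "computable_on (Suc (Suc 1)) (\<lambda>\<alpha> xs. G \<alpha> (xs ! 2) (xs ! 0) (xs ! 1))" by simp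
  from computable_on_rec[OF assms(1)[unfolded computable_def] this]
  have "computable_on 2 ?H" by (simp add: numeral_2_eq_2)
  from computable_on_comp2[OF this assms(3)[unfolded computable_def] computable_on_nth[of 0 1]]
  show ?thesis unfolding computable_def by simp
qed

lemma computable_Least:
  assumes "computable (\<lambda>\<alpha> u. F \<alpha> (pfst u) (psnd u))" "\<And>\<alpha> x. \<exists>n. F \<alpha> x n = 0"
  shows "computable (\<lambda>\<alpha> x. LEAST n. F \<alpha> x n = 0)"
proof -
  have "computable_on (Suc 1) (\<lambda>\<alpha> xs. pair (xs ! 1) (xs ! 0))"
    by (intro computable_on_pair computable_on_nth) auto
  from computable_on_comp1[OF assms(1)[unfolded computable_def] this]
  have "computable_on (Suc 1) (\<lambda>\<alpha> xs. F \<alpha> (xs ! 1) (xs ! 0))" by simp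
  from computable_on_Least[OF this] assms(2) show ?thesis unfolding computable_def by simp
qed

text \<open>A sum of naturals vanishes iff every summand does, which later yields bounded universal
  quantification; a constant summand yields multiplication.\<close>

lemma computable_sum [computable_intros]:
  assumes "computable (\<lambda>\<alpha> u. F \<alpha> (pfst u) (psnd u))" "computable N"
  shows "computable (\<lambda>\<alpha> x. \<Sum>i<N \<alpha> x. F \<alpha> x i)"
proof -
  have "computable (\<lambda>\<alpha> u. psnd (psnd u) + F \<alpha> (pfst u) (pfst (psnd u)))"
    by (intro computable_intros computable_comp2[OF assms(1)])
  from computable_rec[OF computable_const[of 0], of "\<lambda>\<alpha> x n y. y + F \<alpha> x n", OF this assms(2)]
  have "computable (\<lambda>\<alpha> x. rec_nat 0 (\<lambda>n y. y + F \<alpha> x n) (N \<alpha> x))" .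
  moreover have "rec_nat 0 (\<lambda>n y. y + f n) m = (\<Sum>i<m. f i)" for f :: "nat \<Rightarrow> nat" and m
    by (induction m) auto
  ultimately show ?thesis by simp
qed

lemma computable_mult [computable_intros]:
  assumes "computable F" "computable G"
  shows "computable (\<lambda>\<alpha> x. F \<alpha> x * G \<alpha> x)"
proof -
  have "computable (\<lambda>\<alpha> x. \<Sum>i<F \<alpha> x. G \<alpha> x)"
    by (intro computable_intros computable_comp[OF assms(2)] assms)
  then show ?thesis by simp
qed

lemma computable_If_zero [computable_intros]:
  assumes "computable F" "computable G" "computable H"
  shows "computable (\<lambda>\<alpha> x. if F \<alpha> x = 0 then G \<alpha> x else H \<alpha> x)"
proof -
  \<comment> \<open>Since subtraction is truncated, \<open>1 - F \<alpha> x\<close> is the indicator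
    of \<open>F \<alpha> x = 0\<close>, and subtracting it from 1 gives the complementary
    indicator.\<close>
  have "computable (\<lambda>\<alpha> x. (1 - F \<alpha> x) * G \<alpha> x + (1 - (1 - F \<alpha> x)) * H \<alpha> x)"
    by (intro computable_intros assms)
  moreover have "(\<lambda>\<alpha> x. (1 - F \<alpha> x) * G \<alpha> x + (1 - (1 - F \<alpha> x)) * H \<alpha> x) =
    (\<lambda>\<alpha> x. if F \<alpha> x = 0 then G \<alpha> x else H \<alpha> x)" by (intro ext) auto
  ultimately show ?thesis by metis
qed

lemma computable_div2_mod2 [computable_intros]:
  assumes "computable F"
  shows "computable (\<lambda>\<alpha> x. F \<alpha> x div 2)" "computable (\<lambda>\<alpha> x. F \<alpha> x mod 2)"
proof -
  \<comment> \<open>The test says \<open>m < 2 * Suc n\<close>, whose least solution is the integer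
    half.\<close>
  have *: "(LEAST n. Suc m - 2 * Suc n = 0) = m div 2" for m :: nat
    by (rule Least_equality) auto
  have ex: "\<exists>n. Suc x - 2 * Suc n = 0" for x :: nat by (rule exI[of _ x]) simp
  have "computable (\<lambda>\<alpha> x. LEAST n. Suc x - 2 * Suc n = 0)"
    by (rule computable_Least[of "\<lambda>\<alpha> x n. Suc x - 2 * Suc n"]) (intro computable_intros, rule ex)
  then have "computable (\<lambda>\<alpha> x. x div 2)" by (simp only: *)
  from computable_comp[OF this assms] show 1: "computable (\<lambda>\<alpha> x. F \<alpha> x div 2)" .
  have "computable (\<lambda>\<alpha> x. F \<alpha> x - 2 * (F \<alpha> x div 2))"
    by (intro computable_intros 1 assms)
  then show "computable (\<lambda>\<alpha> x. F \<alpha> x mod 2)" by (simp add: minus_mult_div_eq_mod)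
qed

text \<open>Operations on codes of lists as produced by \<open>list_encode\<close>; \<open>lnth\<close> has junk values beyond the end.\<close>
definition lcons :: "nat \<Rightarrow> nat \<Rightarrow> nat" where "lcons x l = Suc (pair x l)"
definition ldrop :: "nat \<Rightarrow> nat \<Rightarrow> nat" where "ldrop n l = list_encode (drop n (list_decode l))"
definition lnth :: "nat \<Rightarrow> nat \<Rightarrow> nat" where "lnth l n = pfst (ldrop n l - 1)"
definition llen :: "nat \<Rightarrow> nat" where "llen l = length (list_decode l)"

lemma list_encode_Cons: "list_encode (x # xs) = lcons x (list_encode xs)"
  by (simp add: lcons_def)

lemma list_decode_lcons [simp]: "list_decode (lcons x l) = x # list_decode l"
  by (simp add: lcons_def)

lemma ldrop_simps: "ldrop 0 l = l" "ldrop (Suc n) l = psnd (ldrop n l - 1)"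
proof -
  show "ldrop 0 l = l" by (simp add: ldrop_def)
  \<comment> \<open>The number 0 codes both the pair (0, 0) and the empty list, so the tail formula
    also holds at the empty list and dropping past the end is harmless.\<close>
  have "psnd 0 = 0" using psnd_pair[of 0 0] by (simp add: prod_encode_def)
  then have tl: "list_encode (tl xs) = psnd (list_encode xs - 1)" for xs
    by (cases xs) simp_all
  show "ldrop (Suc n) l = psnd (ldrop n l - 1)"
    using tl[of "drop n (list_decode l)"] by (simp add: ldrop_def drop_Suc tl_drop)
qed

lemma lnth_eq: "n < llen l \<Longrightarrow> lnth l n = list_decode l ! n"
  unfolding lnth_def ldrop_def llen_def
  by (simp add: Cons_nth_drop_Suc[symmetric])

text \<open>Only the empty list has code 0, so the length is found by counting drops until the code
  is exhausted.\<close>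

lemma llen_eq_Least: "llen l = (LEAST n. ldrop n l = 0)"
proof (rule sym, rule Least_equality)
  show "ldrop (llen l) l = 0" by (simp add: ldrop_def llen_def)
  fix n assume "ldrop n l = 0"
  then have "drop n (list_decode l) = []"
    by (metis ldrop_def list_decode.simps(1) list_encode_inverse)
  then show "llen l \<le> n" by (simp add: llen_def)
qed

lemma computable_lists [computable_intros]:
  assumes "computable F" "computable G"
  shows "computable (\<lambda>\<alpha> x. lcons (F \<alpha> x) (G \<alpha> x))" "computable (\<lambda>\<alpha> x. ldrop (F \<alpha> x) (G \<alpha> x))"
    "computable (\<lambda>\<alpha> x. lnth (F \<alpha> x) (G \<alpha> x))"
proof -
  show "computable (\<lambda>\<alpha> x. lcons (F \<alpha> x) (G \<alpha> x))"
    unfolding lcons_def by (intro computable_intros assms)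
  have *: "rec_nat l (\<lambda>n y. psnd (y - 1)) n = ldrop n l" for n l
    by (induction n) (simp_all add: ldrop_simps)
  have "computable (\<lambda>\<alpha> u. rec_nat (psnd u) (\<lambda>n y. psnd (y - 1)) (pfst u))"
    by (rule computable_rec[of _ "\<lambda>\<alpha> x n y. psnd (y - 1)"]) (intro computable_intros)+
  then have d: "computable (\<lambda>\<alpha> u. ldrop (pfst u) (psnd u))" by (simp only: *)
  show "computable (\<lambda>\<alpha> x. ldrop (F \<alpha> x) (G \<alpha> x))"
    by (rule computable_comp2[OF d assms])
  show "computable (\<lambda>\<alpha> x. lnth (F \<alpha> x) (G \<alpha> x))"
    unfolding lnth_def by (intro computable_intros computable_comp2[OF d] assms)
qed

lemma computable_llen [computable_intros]:
  assumes "computable F"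
  shows "computable (\<lambda>\<alpha> x. llen (F \<alpha> x))"
proof -
  have "computable (\<lambda>\<alpha> x. LEAST n. ldrop n x = 0)"
  proof (rule computable_Least[of "\<lambda>\<alpha> x n. ldrop n x"])
    show "computable (\<lambda>\<alpha> u. ldrop (psnd u) (pfst u))"
      by (intro computable_intros)
    show "\<exists>n. ldrop n x = 0" for x
      by (rule exI[of _ "llen x"]) (simp add: ldrop_def llen_def)
  qed
  from computable_comp[OF this assms] show "computable (\<lambda>\<alpha> x. llen (F \<alpha> x))"
    by (simp add: llen_eq_Least)
qed

section \<open>Semidecidable predicates and their enumeration\<close>

definition semidecidable :: "((nat \<Rightarrow> nat) \<Rightarrow> nat \<Rightarrow> bool) \<Rightarrow> bool" where
  "semidecidable P \<longleftrightarrow> (\<exists>F. computable F \<and> (\<forall>\<alpha> x. P \<alpha> x \<longleftrightarrow> (\<exists>w. F \<alpha> (pair x w) = 0)))"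

lemma semidecidableI:
  assumes "computable (\<lambda>\<alpha> u. F \<alpha> (pfst u) (psnd u))" "\<And>\<alpha> x. P \<alpha> x \<longleftrightarrow> (\<exists>w. F \<alpha> x w = 0)"
  shows "semidecidable P"
  unfolding semidecidable_def using assms by (intro exI[of _ "\<lambda>\<alpha> u. F \<alpha> (pfst u) (psnd u)"]) simp

text \<open>Computability of the test is delivered in composed form, with arbitrary computable terms
  in both slots, so that it can serve directly as an introduction rule.\<close>

lemma semidecidableE:
  assumes "semidecidable P"
  obtains F where "\<And>A B. computable A \<Longrightarrow> computable B \<Longrightarrow> computable (\<lambda>\<alpha> x. F \<alpha> (A \<alpha> x) (B \<alpha> x))"
    "\<And>\<alpha> x. P \<alpha> x \<longleftrightarrow> (\<exists>w. F \<alpha> x w = 0)"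
proof -
  obtain F where F: "computable F" "\<And>\<alpha> x. P \<alpha> x \<longleftrightarrow> (\<exists>w. F \<alpha> (pair x w) = 0)"
    using assms unfolding semidecidable_def by blast
  have "computable (\<lambda>\<alpha> x. F \<alpha> (pair (A \<alpha> x) (B \<alpha> x)))" if "computable A" "computable B" for A B
    by (intro computable_comp[OF F(1)] computable_intros that)
  from that[of "\<lambda>\<alpha> x w. F \<alpha> (pair x w)", OF this F(2)] show ?thesis by blast
qed

named_theorems semidecidable_intros

lemma semidecidable_eq [semidecidable_intros]:
  assumes "computable F" "computable G"
  shows "semidecidable (\<lambda>\<alpha> x. F \<alpha> x = G \<alpha> x)"
  by (rule semidecidableI[of "\<lambda>\<alpha> x w. (F \<alpha> x - G \<alpha> x) + (G \<alpha> x - F \<alpha> x)"])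
    (intro computable_intros computable_comp[OF assms(1)] computable_comp[OF assms(2)], auto)

lemma semidecidable_less [semidecidable_intros]:
  assumes "computable F" "computable G"
  shows "semidecidable (\<lambda>\<alpha> x. F \<alpha> x < G \<alpha> x)"
  by (rule semidecidableI[of "\<lambda>\<alpha> x w. Suc (F \<alpha> x) - G \<alpha> x"])
    (intro computable_intros computable_comp[OF assms(1)] computable_comp[OF assms(2)], auto)

lemma semidecidable_conj [semidecidable_intros]:
  assumes "semidecidable P" "semidecidable Q"
  shows "semidecidable (\<lambda>\<alpha> x. P \<alpha> x \<and> Q \<alpha> x)"
proof -
  from assms(1) obtain F where F: "\<And>A B. computable A \<Longrightarrow> computable B \<Longrightarrow> computable (\<lambda>\<alpha> x. F \<alpha> (A \<alpha> x) (B \<alpha> x))"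
    "\<And>\<alpha> x. P \<alpha> x \<longleftrightarrow> (\<exists>w. F \<alpha> x w = (0::nat))" by (rule semidecidableE) blast
  from assms(2) obtain G where G: "\<And>A B. computable A \<Longrightarrow> computable B \<Longrightarrow> computable (\<lambda>\<alpha> x. G \<alpha> (A \<alpha> x) (B \<alpha> x))"
    "\<And>\<alpha> x. Q \<alpha> x \<longleftrightarrow> (\<exists>w. G \<alpha> x w = (0::nat))" by (rule semidecidableE) blast
  show ?thesis
  proof (rule semidecidableI[of "\<lambda>\<alpha> x w. F \<alpha> x (pfst w) + G \<alpha> x (psnd w)"])
    show "computable (\<lambda>\<alpha> u. F \<alpha> (pfst u) (pfst (psnd u)) + G \<alpha> (pfst u) (psnd (psnd u)))"
      by (intro computable_intros F(1) G(1))
    show "(P \<alpha> x \<and> Q \<alpha> x) = (\<exists>w. F \<alpha> x (pfst w) + G \<alpha> x (psnd w) = 0)" for \<alpha> x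
      by (subst ex_pair_iff) (simp add: F(2) G(2))
  qed
qed

lemma semidecidable_disj [semidecidable_intros]:
  assumes "semidecidable P" "semidecidable Q"
  shows "semidecidable (\<lambda>\<alpha> x. P \<alpha> x \<or> Q \<alpha> x)"
proof -
  from assms(1) obtain F where F: "\<And>A B. computable A \<Longrightarrow> computable B \<Longrightarrow> computable (\<lambda>\<alpha> x. F \<alpha> (A \<alpha> x) (B \<alpha> x))"
    "\<And>\<alpha> x. P \<alpha> x \<longleftrightarrow> (\<exists>w. F \<alpha> x w = (0::nat))" by (rule semidecidableE) blast
  from assms(2) obtain G where G: "\<And>A B. computable A \<Longrightarrow> computable B \<Longrightarrow> computable (\<lambda>\<alpha> x. G \<alpha> (A \<alpha> x) (B \<alpha> x))"
    "\<And>\<alpha> x. Q \<alpha> x \<longleftrightarrow> (\<exists>w. G \<alpha> x w = (0::nat))" by (rule semidecidableE) blast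
  show ?thesis
    \<comment> \<open>A product vanishes iff one factor does, so a witness for either test is a
      witness for the product.\<close>
    by (rule semidecidableI[of "\<lambda>\<alpha> x w. F \<alpha> x w * G \<alpha> x w"])
      (intro computable_intros F(1) G(1), auto simp: F(2) G(2))
qed

lemma semidecidable_ex [semidecidable_intros]:
  assumes "semidecidable (\<lambda>\<alpha> u. P \<alpha> (pfst u) (psnd u))"
  shows "semidecidable (\<lambda>\<alpha> x. \<exists>y. P \<alpha> x y)"
proof -
  from assms(1) obtain F where F: "\<And>A B. computable A \<Longrightarrow> computable B \<Longrightarrow> computable (\<lambda>\<alpha> x. F \<alpha> (A \<alpha> x) (B \<alpha> x))"
    "\<And>\<alpha> u. P \<alpha> (pfst u) (psnd u) \<longleftrightarrow> (\<exists>w. F \<alpha> u w = (0::nat))" by (rule semidecidableE) blast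
  show ?thesis
  proof (rule semidecidableI[of "\<lambda>\<alpha> x w. F \<alpha> (pair x (pfst w)) (psnd w)"])
    show "computable (\<lambda>\<alpha> u. F \<alpha> (pair (pfst u) (pfst (psnd u))) (psnd (psnd u)))"
      by (intro computable_intros F(1))
    show "(\<exists>y. P \<alpha> x y) = (\<exists>w. F \<alpha> (pair x (pfst w)) (psnd w) = 0)" for \<alpha> x
    proof -
      have "P \<alpha> x y \<longleftrightarrow> (\<exists>w. F \<alpha> (pair x y) w = 0)" for y
        using F(2)[of \<alpha> "pair x y"] by simp
      then show ?thesis
        by (subst ex_pair_iff[of "\<lambda>w. F \<alpha> (pair x (pfst w)) (psnd w) = 0"]) auto
    qed
  qed
qed

text \<open>The finitely many witnesses, one for each \<open>i\<close>, are packed into a single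
  list code, and the sum of the tests vanishes iff all of them succeed.\<close>

lemma semidecidable_ball [semidecidable_intros]:
  assumes "semidecidable (\<lambda>\<alpha> u. P \<alpha> (pfst u) (psnd u))" "computable N"
  shows "semidecidable (\<lambda>\<alpha> x. \<forall>i<N \<alpha> x. P \<alpha> x i)"
proof -
  from assms(1) obtain F where F: "\<And>A B. computable A \<Longrightarrow> computable B \<Longrightarrow> computable (\<lambda>\<alpha> x. F \<alpha> (A \<alpha> x) (B \<alpha> x))"
    "\<And>\<alpha> u. P \<alpha> (pfst u) (psnd u) \<longleftrightarrow> (\<exists>w. F \<alpha> u w = (0::nat))" by (rule semidecidableE) blast
  have P: "P \<alpha> x i \<longleftrightarrow> (\<exists>w. F \<alpha> (pair x i) w = 0)" for \<alpha> x i
    using F(2)[of \<alpha> "pair x i"] by simp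
  show ?thesis
  proof (rule semidecidableI[of "\<lambda>\<alpha> x w. \<Sum>i<N \<alpha> x. F \<alpha> (pair x i) (lnth w i)"])
    show "computable (\<lambda>\<alpha> u. \<Sum>i<N \<alpha> (pfst u). F \<alpha> (pair (pfst u) i) (lnth (psnd u) i))"
      by (intro computable_intros F(1) computable_comp[OF assms(2)])
    fix \<alpha> x
    show "(\<forall>i<N \<alpha> x. P \<alpha> x i) = (\<exists>w. (\<Sum>i<N \<alpha> x. F \<alpha> (pair x i) (lnth w i)) = 0)"
    proof
      assume "\<forall>i<N \<alpha> x. P \<alpha> x i"
      then obtain g where g: "\<And>i. i < N \<alpha> x \<Longrightarrow> F \<alpha> (pair x i) (g i) = 0" unfolding P by metis
      define w where "w = list_encode (map g [0..<N \<alpha> x])"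
      have "lnth w i = g i" if "i < N \<alpha> x" for i
        using that by (subst lnth_eq) (simp_all add: llen_def w_def)
      then have "(\<Sum>i<N \<alpha> x. F \<alpha> (pair x i) (lnth w i)) = 0" using g by simp
      then show "\<exists>w. (\<Sum>i<N \<alpha> x. F \<alpha> (pair x i) (lnth w i)) = 0" by blast
    next
      assume "\<exists>w. (\<Sum>i<N \<alpha> x. F \<alpha> (pair x i) (lnth w i)) = 0"
      then show "\<forall>i<N \<alpha> x. P \<alpha> x i" unfolding P by auto
    qed
  qed
qed

lemma semidecidable_comp:
  assumes "semidecidable P" "computable F"
  shows "semidecidable (\<lambda>\<alpha> x. P \<alpha> (F \<alpha> x))"
proof -
  from assms(1) obtain G where G: "\<And>A B. computable A \<Longrightarrow> computable B \<Longrightarrow> computable (\<lambda>\<alpha> x. G \<alpha> (A \<alpha> x) (B \<alpha> x))"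
    "\<And>\<alpha> u. P \<alpha> u \<longleftrightarrow> (\<exists>w. G \<alpha> u w = (0::nat))" by (rule semidecidableE) blast
  show ?thesis
    by (rule semidecidableI[of "\<lambda>\<alpha> x w. G \<alpha> (F \<alpha> x) w"])
      (intro computable_intros G(1) computable_comp[OF assms(2)], simp add: G(2))
qed

text \<open>The index \<open>k\<close> runs over all pairs of a candidate and a witness; a failed
  test writes the padding value 0, so the stream is total even if nothing is ever accepted.\<close>

lemma semidecidable_enumerator:
  assumes "semidecidable (\<lambda>\<alpha> u. P \<alpha> (pfst u) (psnd u))"
  obtains E where "computable (\<lambda>\<alpha> u. E \<alpha> (pfst u) (psnd u))" "\<And>\<alpha> x. listed (E \<alpha> x) = {n. P \<alpha> x n}"
proof -
  from assms(1) obtain F where F: "\<And>A B. computable A \<Longrightarrow> computable B \<Longrightarrow> computable (\<lambda>\<alpha> x. F \<alpha> (A \<alpha> x) (B \<alpha> x))"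
    "\<And>\<alpha> u. P \<alpha> (pfst u) (psnd u) \<longleftrightarrow> (\<exists>w. F \<alpha> u w = (0::nat))" by (rule semidecidableE) blast
  define E where "E \<alpha> x k = (if F \<alpha> (pair x (pfst k)) (psnd k) = 0 then Suc (pfst k) else 0)" for \<alpha> x k
  show ?thesis
  proof
    show "computable (\<lambda>\<alpha> u. E \<alpha> (pfst u) (psnd u))"
      unfolding E_def by (intro computable_intros F(1))
    show "listed (E \<alpha> x) = {n. P \<alpha> x n}" for \<alpha> x
    proof -
      have "(\<exists>k. E \<alpha> x k = Suc n) \<longleftrightarrow> P \<alpha> x n" for n
        using F(2)[of \<alpha> "pair x n"] by (subst ex_pair_iff) (auto simp: E_def)
      then show ?thesis unfolding listed_def by simp
    qed
  qed
qed

section \<open>A universal machine\<close>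

text \<open>Finite proof trees over an arbitrary rule relation, whose second argument codes the list
  of premises. The abstraction separates the search for a tree from the rules of evaluation.\<close>

inductive derivable :: "(nat \<Rightarrow> nat \<Rightarrow> bool) \<Rightarrow> nat \<Rightarrow> bool" for R where
  "R j l \<Longrightarrow> \<forall>p\<in>set (list_decode l). derivable R p \<Longrightarrow> derivable R j"

text \<open>A proof tree flattened into a list, the latest conclusion first. Premises must occur
  further down, which excludes circular reasoning, and the whole tree becomes a single codable
  witness.\<close>

fun derivation :: "(nat \<Rightarrow> nat \<Rightarrow> bool) \<Rightarrow> nat list \<Rightarrow> bool" where
  "derivation R [] = True"
| "derivation R (j # L) = ((\<exists>l. R j l \<and> set (list_decode l) \<subseteq> set L) \<and> derivation R L)"

lemma derivation_append: "derivation R K \<Longrightarrow> derivation R L \<Longrightarrow> derivation R (K @ L)"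
  by (induction K) auto

lemma derivation_sound: "derivation R L \<Longrightarrow> j \<in> set L \<Longrightarrow> derivable R j"
proof (induction L arbitrary: j)
  case (Cons a L)
  then obtain l where "R a l" "\<forall>p\<in>set (list_decode l). derivable R p" by auto
  then have "derivable R a" by (rule derivable.intros)
  with Cons show ?case by auto
qed simp

lemma derivation_complete: "derivable R j \<Longrightarrow> \<exists>L. derivation R L \<and> j \<in> set L"
proof (induction rule: derivable.induct)
  case (1 j l)
  \<comment> \<open>Derivations of the separate premises are concatenated into one list that
    contains them all.\<close>
  have "\<exists>L. derivation R L \<and> set ps \<subseteq> set L"
    if "\<forall>p\<in>set ps. \<exists>L. derivation R L \<and> p \<in> set L" for ps
    using that
  proof (induction ps)
    case Nil
    show ?case by (rule exI[of _ "[]"]) simp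
  next
    case (Cons p ps)
    then obtain K L where "derivation R K" "p \<in> set K" "derivation R L" "set ps \<subseteq> set L" by auto
    then show ?case by (intro exI[of _ "K @ L"]) (auto intro: derivation_append)
  qed
  from this[of "list_decode l"] 1(2) obtain L where "derivation R L" "set (list_decode l) \<subseteq> set L"
    by blast
  with 1(1) show ?case by (intro exI[of _ "j # L"]) auto
qed

lemma derivation_iff_nth:
  "derivation R L \<longleftrightarrow> (\<forall>i<length L. \<exists>l. R (L ! i) l \<and> set (list_decode l) \<subseteq> set (drop (Suc i) L))"
  by (induction L) (simp_all add: All_less_Suc2)

text \<open>Puts the existence of a tree into a shape to which the closure rules for
  \<open>semidecidable\<close> apply: existential quantifiers, bounded universal ones, and
  comparisons of list entries.\<close>

lemma derivable_iff:
  "derivable R j \<longleftrightarrow> (\<exists>w. (\<exists>i. i < llen w \<and> lnth w i = j) \<and>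
    (\<forall>i<llen w. \<exists>l. R (lnth w i) l \<and> (\<forall>k<llen l. \<exists>m. i < m \<and> m < llen w \<and> lnth l k = lnth w m)))"
proof -
  have sub: "set (list_decode l) \<subseteq> set (drop (Suc i) (list_decode w)) \<longleftrightarrow>
      (\<forall>k<llen l. \<exists>m. i < m \<and> m < llen w \<and> lnth l k = lnth w m)" (is "?A \<longleftrightarrow> ?B") for l i w
  proof
    assume ?A
    show ?B
    proof (intro allI impI)
      fix k assume k: "k < llen l"
      then have "list_decode l ! k \<in> set (drop (Suc i) (list_decode w))"
        using \<open>?A\<close> by (auto simp: llen_def)
      then obtain m where "m < llen w - Suc i" "list_decode l ! k = list_decode w ! (Suc i + m)"
        by (auto simp: in_set_conv_nth llen_def)
      then show "\<exists>m. i < m \<and> m < llen w \<and> lnth l k = lnth w m"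
        using k by (intro exI[of _ "Suc i + m"]) (auto simp: lnth_eq)
    qed
  next
    assume B: ?B
    show ?A
    proof
      fix p assume "p \<in> set (list_decode l)"
      then obtain k where "k < llen l" "lnth l k = p"
        by (auto simp: in_set_conv_nth llen_def lnth_eq)
      with B obtain m where m: "i < m" "m < llen w" "p = list_decode w ! m"
        by (metis lnth_eq)
      have "drop (Suc i) (list_decode w) ! (m - Suc i) = p" "m - Suc i < length (drop (Suc i) (list_decode w))"
        using m by (auto simp: llen_def)
      then show "p \<in> set (drop (Suc i) (list_decode w))" by (metis nth_mem)
    qed
  qed
  have "derivable R j \<longleftrightarrow> (\<exists>w. derivation R (list_decode w) \<and> j \<in> set (list_decode w))"
    using derivation_sound derivation_complete by (metis list_encode_inverse)
  also have "\<dots> \<longleftrightarrow> (\<exists>w. (\<exists>i. i < llen w \<and> lnth w i = j) \<and>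
      (\<forall>i<llen w. \<exists>l. R (lnth w i) l \<and> (\<forall>k<llen l. \<exists>m. i < m \<and> m < llen w \<and> lnth l k = lnth w m)))"
  proof (rule ex_cong1)
    fix w
    have "j \<in> set (list_decode w) \<longleftrightarrow> (\<exists>i. i < llen w \<and> lnth w i = j)"
      unfolding in_set_conv_nth using lnth_eq by (metis llen_def)
    moreover have "derivation R (list_decode w) \<longleftrightarrow>
      (\<forall>i<llen w. \<exists>l. R (lnth w i) l \<and> (\<forall>k<llen l. \<exists>m. i < m \<and> m < llen w \<and> lnth l k = lnth w m))"
      unfolding derivation_iff_nth sub llen_def[symmetric] using lnth_eq[of _ w] by simp
    ultimately show "(derivation R (list_decode w) \<and> j \<in> set (list_decode w)) \<longleftrightarrow> (\<exists>i. i < llen w \<and> lnth w i = j) \<and>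
      (\<forall>i<llen w. \<exists>l. R (lnth w i) l \<and> (\<forall>k<llen l. \<exists>m. i < m \<and> m < llen w \<and> lnth l k = lnth w m))"
      by blast
  qed
  finally show ?thesis .
qed

lemma semidecidable_derivable:
  assumes "semidecidable (\<lambda>\<alpha> u. R \<alpha> (pfst u) (pfst (psnd u)) (psnd (psnd u)))"
    and "computable X" "computable J"
  shows "semidecidable (\<lambda>\<alpha> x. derivable (R \<alpha> (X \<alpha> x)) (J \<alpha> x))"
proof -
  have R: "semidecidable (\<lambda>\<alpha> x. R \<alpha> (A \<alpha> x) (B \<alpha> x) (C \<alpha> x))"
    if "computable A" "computable B" "computable C" for A B C
  proof -
    have "computable (\<lambda>\<alpha> x. pair (A \<alpha> x) (pair (B \<alpha> x) (C \<alpha> x)))"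
      by (intro computable_intros that)
    from semidecidable_comp[OF assms(1) this] show ?thesis by simp
  qed
  show ?thesis unfolding derivable_iff
    by (intro semidecidable_intros computable_intros R computable_comp[OF assms(2)] computable_comp[OF assms(3)])
qed

text \<open>The number \<open>verdict e xs y\<close> says that the program with code \<open>e\<close> maps the coded
  argument list \<open>xs\<close> to \<open>y\<close>; the disjuncts of \<open>eval_rule\<close> are the rules of \<open>eval\<close>, with the coded list of
  their premises as second argument.\<close>
abbreviation verdict :: "nat \<Rightarrow> nat \<Rightarrow> nat \<Rightarrow> nat" where
  "verdict e xs y \<equiv> pair e (pair xs y)"

definition eval_rule :: "(nat \<Rightarrow> nat) \<Rightarrow> nat \<Rightarrow> nat \<Rightarrow> bool" where
  "eval_rule \<beta> j l \<longleftrightarrow>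
    (\<exists>xs. j = verdict (code Zf) xs 0 \<and> l = 0) \<or>
    (\<exists>x xs. j = verdict (code Sf) (lcons x xs) (Suc x) \<and> l = 0) \<or>
    (\<exists>i xs. i < llen xs \<and> j = verdict (pair 2 i) xs (lnth xs i) \<and> l = 0) \<or>
    (\<exists>x xs. j = verdict (code Orc) (lcons x xs) (\<beta> x) \<and> l = 0) \<or>
    (\<exists>f gs xs ys y k. llen ys = llen gs \<and> llen k = llen gs \<and>
       (\<forall>i<llen gs. lnth k i = verdict (lnth gs i) xs (lnth ys i)) \<and>
       j = verdict (pair 4 (pair f gs)) xs y \<and> l = lcons (verdict f ys y) k) \<or>
    (\<exists>f g xs y. j = verdict (pair 5 (pair f g)) (lcons 0 xs) y \<and> l = lcons (verdict f xs y) 0) \<or>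
    (\<exists>f g n xs y z. j = verdict (pair 5 (pair f g)) (lcons (Suc n) xs) z \<and>
       l = lcons (verdict (pair 5 (pair f g)) (lcons n xs) y) (lcons (verdict g (lcons n (lcons y xs)) z) 0)) \<or>
    (\<exists>f n xs k. llen k = n \<and> (\<forall>m<n. \<exists>y. lnth k m = verdict f (lcons m xs) (Suc y)) \<and>
       j = verdict (pair 6 f) xs n \<and> l = lcons (verdict f (lcons n xs) 0) k)"

lemma semidecidable_eval_rule:
  assumes "computable (\<lambda>\<alpha> u. B \<alpha> (pfst u) (psnd u))"
  shows "semidecidable (\<lambda>\<alpha> u. eval_rule (B \<alpha> (pfst u)) (pfst (psnd u)) (psnd (psnd u)))"
  unfolding eval_rule_def
  by (intro semidecidable_intros computable_intros computable_comp2[OF assms])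

lemma eval_imp_derivable:
  "eval \<beta> M xs y \<Longrightarrow> derivable (eval_rule \<beta>) (verdict (code M) (list_encode xs) y)"
proof (induction rule: eval.induct)
  case (eval_Z xs)
  show ?case
    by (rule derivable.intros[where l = 0]) (auto simp: eval_rule_def)
next
  case (eval_S x xs)
  show ?case
    by (rule derivable.intros[where l = 0]) (auto simp: eval_rule_def lcons_def)
next
  case (eval_Proj i xs)
  have "i < llen (list_encode xs) \<and> xs ! i = lnth (list_encode xs) i"
    using eval_Proj by (simp add: llen_def lnth_eq)
  then show ?case
    by (intro derivable.intros[where l = 0]) (auto simp: eval_rule_def)
next
  case (eval_Orc x xs)
  show ?case
    by (rule derivable.intros[where l = 0]) (auto simp: eval_rule_def lcons_def)
next
  case (eval_Comp ys gs xs f z)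
  \<comment> \<open>These are the premises for the inner programs; the premise for the outer program
    is put in front of them.\<close>
  define k where "k = list_encode (map (\<lambda>i. verdict (code (gs ! i)) (list_encode xs) (ys ! i)) [0..<length gs])"
  have len: "llen (list_encode ys) = length gs" "llen (list_encode (map code gs)) = length gs" "llen k = length gs"
    using eval_Comp(1) by (auto simp: llen_def k_def)
  have "eval_rule \<beta> (verdict (code (Comp f gs)) (list_encode xs) z) (lcons (verdict (code f) (list_encode ys) z) k)"
    unfolding eval_rule_def
  proof (rule disjI2, rule disjI2, rule disjI2, rule disjI2, rule disjI1, intro exI conjI)
    show "\<forall>i<llen (list_encode (map code gs)). lnth k i = verdict (lnth (list_encode (map code gs)) i) (list_encode xs) (lnth (list_encode ys) i)"
      using len eval_Comp(1) by (simp add: lnth_eq) (simp add: k_def)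
  qed (use len in auto)
  then show ?case
    by (rule derivable.intros) (use eval_Comp in \<open>auto simp: k_def\<close>)
next
  case (eval_Prim0 f xs y g)
  show ?case
    by (rule derivable.intros[where l = "lcons (verdict (code f) (list_encode xs) y) 0"])
      (use eval_Prim0 in \<open>auto simp: eval_rule_def lcons_def\<close>)
next
  case (eval_PrimS f g n xs y z)
  let ?l = "lcons (verdict (code (Prim f g)) (lcons n (list_encode xs)) y)
    (lcons (verdict (code g) (lcons n (lcons y (list_encode xs))) z) 0)"
  have "eval_rule \<beta> (verdict (code (Prim f g)) (list_encode (Suc n # xs)) z) ?l"
    unfolding eval_rule_def list_encode_Cons
    by (rule disjI2, rule disjI2, rule disjI2, rule disjI2, rule disjI2, rule disjI2, rule disjI1, intro exI conjI) auto
  then show ?case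
    by (rule derivable.intros) (use eval_PrimS in \<open>auto simp: list_encode_Cons[symmetric] simp del: list_encode.simps code.simps\<close>)
next
  case (eval_Mn f n xs)
  \<comment> \<open>A verdict names the value it claims, so the nonzero values at arguments below
    \<open>n\<close> are fixed before the premise list can be written down.\<close>
  then obtain y where y: "\<And>m. m < n \<Longrightarrow> 0 < y m \<and> derivable (eval_rule \<beta>) (verdict (code f) (list_encode (m # xs)) (y m))"
    by metis
  define k where "k = list_encode (map (\<lambda>m. verdict (code f) (list_encode (m # xs)) (y m)) [0..<n])"
  have len: "llen k = n" by (simp add: llen_def k_def)
  have "eval_rule \<beta> (verdict (code (Mn f)) (list_encode xs) n) (lcons (verdict (code f) (lcons n (list_encode xs)) 0) k)"
    unfolding eval_rule_def
  proof (intro disjI2 exI conjI)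
    show "\<forall>m<n. \<exists>v. lnth k m = verdict (code f) (lcons m (list_encode xs)) (Suc v)"
    proof (intro allI impI)
      fix m assume m: "m < n"
      then obtain v where "y m = Suc v" using y[OF m] by (cases "y m") auto
      then show "\<exists>v. lnth k m = verdict (code f) (lcons m (list_encode xs)) (Suc v)"
        using m len by (intro exI[of _ v]) (simp add: lnth_eq, simp add: k_def list_encode_Cons del: list_encode.simps)
    qed
  qed (use len in auto)
  then show ?case
    by (rule derivable.intros)
      (use y eval_Mn(2) in \<open>auto simp: k_def list_encode_Cons[symmetric] simp del: list_encode.simps\<close>)
qed

text \<open>Numbers in a verdict need not code programs, so the claim is made only for verdicts
  about some \<open>code M\<close>. The constructor tag then determines the shape of
  \<open>M\<close> and forces the program numbers in the premises to be codes again, which keeps the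
  induction going.\<close>

lemma derivable_imp_eval:
  "derivable (eval_rule \<beta>) j \<Longrightarrow> j = verdict (code M) (list_encode xs) y \<Longrightarrow> eval \<beta> M xs y"
proof (induction arbitrary: M xs y rule: derivable.induct)
  case (1 j l)
  have IH: "eval \<beta> M xs y" if "verdict (code M) (list_encode xs) y \<in> set (list_decode l)" for M xs y
    using 1(2) that by blast
  have lc: "list_encode as = lcons b c \<longleftrightarrow> as = b # list_decode c" for as b c
    by (metis list_decode_lcons list_encode_inverse list_decode_inverse)
  from 1(1)[unfolded eval_rule_def] show ?case
  proof (elim disjE exE conjE)
    fix x xs' assume "j = verdict (code Zf) xs' 0"
    then show ?thesis using 1(3) by (cases M) (auto intro: eval.intros)
  next
    fix x xs' assume "j = verdict (code Sf) (lcons x xs') (Suc x)"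
    then show ?thesis using 1(3) by (cases M) (auto simp: lc eq_commute[of "lcons _ _"] intro: eval.intros)
  next
    fix i xs' assume "i < llen xs'" "j = verdict (pair 2 i) xs' (lnth xs' i)"
    then show ?thesis using 1(3) by (cases M) (auto simp: lnth_eq llen_def intro: eval.intros)
  next
    fix x xs' assume "j = verdict (code Orc) (lcons x xs') (\<beta> x)"
    then show ?thesis using 1(3) by (cases M) (auto simp: lc eq_commute[of "lcons _ _"] intro: eval.intros)
  next
    fix f gs xs' ys y' k
    assume *: "llen ys = llen gs" "llen k = llen gs"
       "\<forall>i<llen gs. lnth k i = verdict (lnth gs i) xs' (lnth ys i)"
       "j = verdict (pair 4 (pair f gs)) xs' y'" "l = lcons (verdict f ys y') k"
    then obtain F Gs where M: "M = Comp F Gs" "f = code F" "gs = list_encode (map code Gs)"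
      and xs: "xs' = list_encode xs" "y' = y" using 1(3) by (cases M) auto
    show ?thesis unfolding M
    proof (rule eval_Comp)
      show "length (list_decode ys) = length Gs" using * by (simp add: M llen_def)
      show "eval \<beta> F (list_decode ys) y" by (rule IH) (simp add: * M xs)
      show "\<forall>i<length Gs. eval \<beta> (Gs ! i) xs (list_decode ys ! i)"
      proof (intro allI impI)
        fix i assume i: "i < length Gs"
        then have "lnth k i = verdict (code (Gs ! i)) (list_encode xs) (list_decode ys ! i)"
          using *(1-3) by (simp add: M xs lnth_eq llen_def)
        moreover have "lnth k i \<in> set (list_decode l)"
          using i * nth_mem[of i "list_decode k"] by (simp add: lnth_eq M llen_def)
        ultimately show "eval \<beta> (Gs ! i) xs (list_decode ys ! i)" by (intro IH) simp
      qed
    qed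
  next
    fix f g xs' y' assume *: "j = verdict (pair 5 (pair f g)) (lcons 0 xs') y'" "l = lcons (verdict f xs' y') 0"
    then obtain F G where M: "M = Prim F G" "f = code F" "xs = 0 # list_decode xs'" "y' = y"
      using 1(3) by (cases M) (auto simp: lc eq_commute[of "lcons _ _"])
    show ?thesis unfolding M by (intro eval_Prim0 IH) (simp add: * M)
  next
    fix f g n xs' y' z
    assume *: "j = verdict (pair 5 (pair f g)) (lcons (Suc n) xs') z"
      "l = lcons (verdict (pair 5 (pair f g)) (lcons n xs') y') (lcons (verdict g (lcons n (lcons y' xs')) z) 0)"
    then obtain F G where M: "M = Prim F G" "f = code F" "g = code G" "xs = Suc n # list_decode xs'" "z = y"
      using 1(3) by (cases M) (auto simp: lc eq_commute[of "lcons _ _"])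
    show ?thesis unfolding M
      by (intro eval_PrimS[where y = y'] IH) (simp_all add: * M lcons_def)
  next
    fix f n xs' k
    assume *: "llen k = n" "\<forall>m<n. \<exists>y. lnth k m = verdict f (lcons m xs') (Suc y)"
       "j = verdict (pair 6 f) xs' n" "l = lcons (verdict f (lcons n xs') 0) k"
    then obtain F where M: "M = Mn F" "f = code F" "xs' = list_encode xs" "n = y"
      using 1(3) by (cases M) auto
    show ?thesis unfolding M
    proof (intro eval_Mn allI impI)
      show "eval \<beta> F (y # xs) 0" by (intro IH) (simp add: * M lcons_def)
      fix m assume m: "m < y"
      with *(2) M obtain v where v: "lnth k m = verdict (code F) (list_encode (m # xs)) (Suc v)"
        by (auto simp: list_encode_Cons simp del: list_encode.simps)
      have "lnth k m \<in> set (list_decode l)"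
        using m * M(4) nth_mem[of m "list_decode k"] by (simp add: lnth_eq llen_def)
      then show "\<exists>v>0. eval \<beta> F (m # xs) v" unfolding v using IH by blast
    qed
  qed
qed

lemma derivable_iff_eval:
  "derivable (eval_rule \<beta>) (verdict (code M) (list_encode xs) y) \<longleftrightarrow> eval \<beta> M xs y"
  using eval_imp_derivable derivable_imp_eval by blast

inductive_cases eval_caseE:
  "eval \<alpha> Zf xs z" "eval \<alpha> Sf xs z" "eval \<alpha> (Proj i) xs z" "eval \<alpha> Orc xs z"
  "eval \<alpha> (Comp f gs) xs z" "eval \<alpha> (Prim f g) (0 # xs) z" "eval \<alpha> (Prim f g) (Suc n # xs) z"
  "eval \<alpha> (Mn f) xs z"

text \<open>A simulation finds some value of the program, while \<open>computes\<close> provides a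
  particular stream of values; uniqueness identifies the two.\<close>

lemma eval_deterministic: "eval \<alpha> M xs y \<Longrightarrow> eval \<alpha> M xs z \<Longrightarrow> y = z"
proof (induction arbitrary: z rule: eval.induct)
  case (eval_Comp ys gs xs f y)
  from eval_Comp.prems obtain zs where zs: "length zs = length gs"
    "\<forall>i<length gs. eval \<alpha> (gs ! i) xs (zs ! i)" "eval \<alpha> f zs z" by (auto elim: eval_caseE)
  have "ys = zs" using eval_Comp zs by (intro nth_equalityI) auto
  then show ?case using eval_Comp zs by simp
next
  case (eval_Mn f n xs)
  from eval_Mn.prems have z: "eval \<alpha> f (z # xs) 0" "\<forall>m<z. \<exists>y>0. eval \<alpha> f (m # xs) y"
    by (auto elim: eval_caseE)
  \<comment> \<open>The smaller of two different results would have to give both the value 0 and a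
    positive value.\<close>
  show ?case
  proof (cases n z rule: linorder_cases)
    case less
    then show ?thesis using z(2) eval_Mn by fastforce
  next
    case greater
    then show ?thesis using z(1) eval_Mn.IH(2) by fastforce
  qed
next
  case (eval_PrimS f g n xs y w)
  from eval_PrimS.prems obtain y' where "eval \<alpha> (Prim f g) (n # xs) y'" "eval \<alpha> g (n # y' # xs) z"
    by (auto elim: eval_caseE)
  then show ?case using eval_PrimS by blast
next
  case (eval_Prim0 f xs y g)
  from eval_Prim0.prems have "eval \<alpha> f xs z" by (rule eval_caseE)
  then show ?case by (rule eval_Prim0.IH)
qed (auto elim: eval_caseE)

section \<open>Rational arithmetic\<close>

text \<open>A difference of naturals over a successor: signs need no coding of integers, and the
  denominator cannot vanish.\<close>

definition rational_computable :: "((nat \<Rightarrow> nat) \<Rightarrow> nat \<Rightarrow> real) \<Rightarrow> bool" where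
  "rational_computable F \<longleftrightarrow> (\<exists>A B C. computable A \<and> computable B \<and> computable C \<and>
     (\<forall>\<alpha> x. F \<alpha> x = (real (A \<alpha> x) - real (B \<alpha> x)) / real (Suc (C \<alpha> x))))"

lemma rational_computableI:
  assumes "computable A" "computable B" "computable C"
    "\<And>\<alpha> x. F \<alpha> x = (real (A \<alpha> x) - real (B \<alpha> x)) / real (Suc (C \<alpha> x))"
  shows "rational_computable F"
  using assms unfolding rational_computable_def by blast

lemma rational_computableE:
  assumes "rational_computable F"
  obtains A B C where "computable A" "computable B" "computable C"
    "F = (\<lambda>\<alpha> x. (real (A \<alpha> x) - real (B \<alpha> x)) / real (Suc (C \<alpha> x)))"
  using assms unfolding rational_computable_def by blast

lemma semidecidable_rational_less [semidecidable_intros]: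
  assumes "rational_computable F" "rational_computable G"
  shows "semidecidable (\<lambda>\<alpha> x. F \<alpha> x < G \<alpha> x)"
proof -
  obtain A B C where F: "computable A" "computable B" "computable C"
    "F = (\<lambda>\<alpha> x. (real (A \<alpha> x) - real (B \<alpha> x)) / real (Suc (C \<alpha> x)))"
    using assms(1) by (rule rational_computableE)
  obtain A' B' C' where G: "computable A'" "computable B'" "computable C'"
    "G = (\<lambda>\<alpha> x. (real (A' \<alpha> x) - real (B' \<alpha> x)) / real (Suc (C' \<alpha> x)))"
    using assms(2) by (rule rational_computableE)
  \<comment> \<open>Cross-multiplying by the positive denominators and moving subtracted terms to
    the other side leaves a comparison of natural numbers.\<close>
  have "(real a - real b) / real (Suc c) < (real a' - real b') / real (Suc c') \<longleftrightarrow>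
      a * Suc c' + b' * Suc c < a' * Suc c + b * Suc c'" for a b c a' b' c'
  proof -
    have "(real a - real b) / real (Suc c) < (real a' - real b') / real (Suc c') \<longleftrightarrow>
        (real a - real b) * real (Suc c') < (real a' - real b') * real (Suc c)"
      by (simp add: divide_simps mult.commute del: of_nat_Suc)
    also have "\<dots> \<longleftrightarrow> real (a * Suc c' + b' * Suc c) < real (a' * Suc c + b * Suc c')"
      by (simp add: algebra_simps)
    finally show ?thesis by (simp only: of_nat_less_iff)
  qed
  moreover have "semidecidable (\<lambda>\<alpha> x. A \<alpha> x * Suc (C' \<alpha> x) + B' \<alpha> x * Suc (C \<alpha> x) <
      A' \<alpha> x * Suc (C \<alpha> x) + B \<alpha> x * Suc (C' \<alpha> x))"
    by (intro semidecidable_intros computable_intros F G)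
  ultimately show ?thesis unfolding F(4) G(4) by simp
qed

named_theorems rational_intros

lemma rational_computable_of_nat [rational_intros]:
  assumes "computable F"
  shows "rational_computable (\<lambda>\<alpha> x. real (F \<alpha> x))"
  by (rule rational_computableI[OF assms computable_const[of 0] computable_const[of 0]]) simp

lemma rational_computable_const_of_nat: "rational_computable (\<lambda>\<alpha> x. real n)"
  by (intro rational_intros computable_intros)

lemma rational_computable_numeral [rational_intros]:
  "rational_computable (\<lambda>\<alpha> x. 0)" "rational_computable (\<lambda>\<alpha> x. numeral n)"
  using rational_computable_const_of_nat[of 0] rational_computable_const_of_nat[of "numeral n"] by simp_all

lemma rational_computable_uminus [rational_intros]:
  assumes "rational_computable F"
  shows "rational_computable (\<lambda>\<alpha> x. - F \<alpha> x)"
proof -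
  obtain A B C where F: "computable A" "computable B" "computable C"
    "F = (\<lambda>\<alpha> x. (real (A \<alpha> x) - real (B \<alpha> x)) / real (Suc (C \<alpha> x)))"
    using assms(1) by (rule rational_computableE)
  show ?thesis
    by (rule rational_computableI[OF F(2,1,3)]) (simp add: F(4) minus_divide_left)
qed

lemma rational_computable_add [rational_intros]:
  assumes "rational_computable F" "rational_computable G"
  shows "rational_computable (\<lambda>\<alpha> x. F \<alpha> x + G \<alpha> x)"
proof -
  obtain A B C where F: "computable A" "computable B" "computable C"
    "F = (\<lambda>\<alpha> x. (real (A \<alpha> x) - real (B \<alpha> x)) / real (Suc (C \<alpha> x)))"
    using assms(1) by (rule rational_computableE)
  obtain A' B' C' where G: "computable A'" "computable B'" "computable C'"
    "G = (\<lambda>\<alpha> x. (real (A' \<alpha> x) - real (B' \<alpha> x)) / real (Suc (C' \<alpha> x)))"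
    using assms(2) by (rule rational_computableE)
  show ?thesis
  proof (rule rational_computableI)
    \<comment> \<open>The stored denominator is one less than the actual one, hence the subtraction
      of 1 in the last term.\<close>
    show "computable (\<lambda>\<alpha> x. A \<alpha> x * Suc (C' \<alpha> x) + A' \<alpha> x * Suc (C \<alpha> x))"
      "computable (\<lambda>\<alpha> x. B \<alpha> x * Suc (C' \<alpha> x) + B' \<alpha> x * Suc (C \<alpha> x))"
      "computable (\<lambda>\<alpha> x. Suc (C \<alpha> x) * Suc (C' \<alpha> x) - 1)"
      by (intro computable_intros F G)+
    fix \<alpha> x
    have S: "real (Suc (Suc (C \<alpha> x) * Suc (C' \<alpha> x) - 1)) = real (Suc (C \<alpha> x)) * real (Suc (C' \<alpha> x))"
      by (simp add: algebra_simps)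
    have nz: "real (Suc (C \<alpha> x)) \<noteq> 0" "real (Suc (C' \<alpha> x)) \<noteq> 0" by simp_all
    show "F \<alpha> x + G \<alpha> x = (real (A \<alpha> x * Suc (C' \<alpha> x) + A' \<alpha> x * Suc (C \<alpha> x)) -
        real (B \<alpha> x * Suc (C' \<alpha> x) + B' \<alpha> x * Suc (C \<alpha> x))) / real (Suc (Suc (C \<alpha> x) * Suc (C' \<alpha> x) - 1))"
      unfolding F(4) G(4) S add_frac_eq[OF nz] by (simp add: algebra_simps)
  qed
qed

lemma rational_computable_diff [rational_intros]:
  assumes "rational_computable F" "rational_computable G"
  shows "rational_computable (\<lambda>\<alpha> x. F \<alpha> x - G \<alpha> x)"
  using rational_computable_add[OF assms(1) rational_computable_uminus[OF assms(2)]] by simp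

lemma rational_computable_mult [rational_intros]:
  assumes "rational_computable F" "rational_computable G"
  shows "rational_computable (\<lambda>\<alpha> x. F \<alpha> x * G \<alpha> x)"
proof -
  obtain A B C where F: "computable A" "computable B" "computable C"
    "F = (\<lambda>\<alpha> x. (real (A \<alpha> x) - real (B \<alpha> x)) / real (Suc (C \<alpha> x)))"
    using assms(1) by (rule rational_computableE)
  obtain A' B' C' where G: "computable A'" "computable B'" "computable C'"
    "G = (\<lambda>\<alpha> x. (real (A' \<alpha> x) - real (B' \<alpha> x)) / real (Suc (C' \<alpha> x)))"
    using assms(2) by (rule rational_computableE)
  show ?thesis
  proof (rule rational_computableI)
    show "computable (\<lambda>\<alpha> x. A \<alpha> x * A' \<alpha> x + B \<alpha> x * B' \<alpha> x)"
      "computable (\<lambda>\<alpha> x. A \<alpha> x * B' \<alpha> x + B \<alpha> x * A' \<alpha> x)"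
      "computable (\<lambda>\<alpha> x. Suc (C \<alpha> x) * Suc (C' \<alpha> x) - 1)"
      by (intro computable_intros F G)+
    fix \<alpha> x
    have S: "real (Suc (Suc (C \<alpha> x) * Suc (C' \<alpha> x) - 1)) = real (Suc (C \<alpha> x)) * real (Suc (C' \<alpha> x))"
      by (simp add: algebra_simps)
    show "F \<alpha> x * G \<alpha> x = (real (A \<alpha> x * A' \<alpha> x + B \<alpha> x * B' \<alpha> x) -
        real (A \<alpha> x * B' \<alpha> x + B \<alpha> x * A' \<alpha> x)) / real (Suc (Suc (C \<alpha> x) * Suc (C' \<alpha> x) - 1))"
      unfolding F(4) G(4) S times_divide_times_eq by (simp add: algebra_simps)
  qed
qed

lemma rational_computable_rat_code [rational_intros]:
  assumes "computable F"
  shows "rational_computable (\<lambda>\<alpha> x. rat_code (F \<alpha> x))"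
proof (rule rational_computableI)
  let ?a = "\<lambda>\<alpha> x. pfst (F \<alpha> x)"
  \<comment> \<open>\<open>int_decode\<close> sends an even code \<open>m\<close> to
    \<open>m div 2\<close> and an odd one to minus \<open>Suc (m div 2)\<close>; these are the
    positive and negative parts.\<close>
  show "computable (\<lambda>\<alpha> x. if ?a \<alpha> x mod 2 = 0 then ?a \<alpha> x div 2 else 0)"
    "computable (\<lambda>\<alpha> x. if ?a \<alpha> x mod 2 = 0 then 0 else Suc (?a \<alpha> x div 2))"
    "computable (\<lambda>\<alpha> x. psnd (F \<alpha> x))"
    by (intro computable_intros assms)+
  fix \<alpha> x
  show "rat_code (F \<alpha> x) = (real (if ?a \<alpha> x mod 2 = 0 then ?a \<alpha> x div 2 else 0) -
      real (if ?a \<alpha> x mod 2 = 0 then 0 else Suc (?a \<alpha> x div 2))) / real (Suc (psnd (F \<alpha> x)))"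
    by (auto simp: rat_code_def pfst_def psnd_def int_decode_def sum_decode_def even_iff_mod_2_eq_zero
        split: prod.splits)
qed

lemma rat_code_surj: "\<exists>a. rat_code a = of_rat q"
proof -
  obtain n d where q: "quotient_of q = (n, d)" by fastforce
  then have d: "d > 0" "q = of_int n / of_int d"
    using quotient_of_denom_pos quotient_of_div by auto
  then show ?thesis
    by (intro exI[of _ "pair (int_encode n) (nat d - 1)"])
      (simp add: rat_code_def of_rat_divide)
qed

lemma rat_code_dense: "x < y \<Longrightarrow> \<exists>a. x < rat_code a \<and> rat_code a < y"
  using of_rat_dense rat_code_surj by metis

section \<open>Univalent functions omitting a value\<close>

text \<open>If \<open>g\<close> is univalent and omits \<open>a\<close>, then a square root \<open>h\<close> of \<open>(a - g) / (a - g z)\<close> with \<open>h z = - 1\<close>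
  omits both \<open>0\<close> and \<open>1\<close>, so that Schottky's theorem bounds it.\<close>
lemma univalent_omitting_bound:
  "\<exists>N::nat. \<forall>g z s a w. g holomorphic_on ball z s \<and> inj_on g (ball z s) \<and> a \<notin> g ` ball z s \<and>
     norm (w - z) < s / 2 \<longrightarrow> norm (g w - g z) \<le> real N * norm (a - g z)"
proof -
  \<comment> \<open>Schottky's bound for a function of norm at most 1 at the centre, taken on the
    disk of radius 2/3. In \<open>N\<close> the square comes from undoing the root and the 1 from
    the triangle inequality.\<close>
  define K where "K = exp (pi * exp (pi * (2 + 2 * 1 + 12 * (2/3) / (1 - 2/3))))"
  obtain N :: nat where N: "1 + K^2 \<le> real N" using real_arch_simple by blast
  have "norm (g w - g z) \<le> real N * norm (a - g z)"
    if hol: "g holomorphic_on ball z s" and inj: "inj_on g (ball z s)" and a: "a \<notin> g ` ball z s"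
      and w: "norm (w - z) < s / 2" for g z s a w
  proof -
    have s: "s > 0" using w norm_ge_zero[of "w - z"] by linarith
    then have zb: "z \<in> ball z s" and wb: "w \<in> ball z s"
      using w by (auto simp: dist_norm norm_minus_commute)
    then have az: "a - g z \<noteq> 0" using a by auto
    have "(\<lambda>u. (a - g u) / (a - g z)) holomorphic_on ball z s"
      using az by (intro holomorphic_intros hol) auto
    moreover have "contractible (ball z s)" using s by (intro convex_imp_contractible) auto
    moreover have "(a - g u) / (a - g z) \<noteq> 0" if "u \<in> ball z s" for u
      using az a that by auto
    ultimately obtain h where h: "h holomorphic_on ball z s"
      "\<And>u. u \<in> ball z s \<Longrightarrow> (a - g u) / (a - g z) = h u ^ 2"
      by (rule contractible_imp_holomorphic_sqrt) auto
    have hz: "h z ^ 2 = 1" using h(2)[OF zb] az by simp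
    \<comment> \<open>Since \<open>h z\<close> is 1 or -1, this choice of sign makes
      \<open>k z\<close> equal to -1.\<close>
    define k where "k u = - (h u * h z)" for u
    \<comment> \<open>Schottky's theorem is applied on a closed disk, which radius
      \<open>3/4 * s\<close> keeps inside the ball; points within \<open>s / 2\<close> of
      \<open>z\<close> then rescale to norm at most (1/2)/(3/4) = 2/3.\<close>
    define F where "F \<zeta> = k (z + of_real (3/4 * s) * \<zeta>)" for \<zeta>
    have mem: "z + of_real (3/4 * s) * \<zeta> \<in> ball z s" if "\<zeta> \<in> cball 0 1" for \<zeta>
    proof -
      have "dist z (z + of_real (3/4 * s) * \<zeta>) = 3/4 * s * norm \<zeta>"
        using s by (simp add: dist_norm norm_mult)
      also have "\<dots> \<le> 3/4 * s * 1" using that s by (intro mult_left_mono) auto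
      finally show ?thesis using s by simp
    qed
    have k2: "k u ^ 2 = (a - g u) / (a - g z)" if "u \<in> ball z s" for u
      using h(2)[OF that] hz by (simp add: k_def power_mult_distrib)
    have kz: "k z = - 1" using hz by (simp add: k_def power2_eq_square)
    have holF: "F holomorphic_on cball 0 1"
    proof -
      have "k holomorphic_on ball z s" unfolding k_def by (intro holomorphic_intros h)
      then have "k \<circ> (\<lambda>\<zeta>. z + of_real (3/4 * s) * \<zeta>) holomorphic_on cball 0 1"
        by (rule holomorphic_on_compose_gen[rotated]) (use mem in \<open>auto intro!: holomorphic_intros\<close>)
      moreover have "F = k \<circ> (\<lambda>\<zeta>. z + of_real (3/4 * s) * \<zeta>)" by (simp add: fun_eq_iff F_def)
      ultimately show ?thesis by simp
    qed
    have omit: "\<not> (F \<zeta> = 0 \<or> F \<zeta> = 1)" if "\<zeta> \<in> cball 0 1" for \<zeta>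
    proof -
      define u where "u = z + of_real (3/4 * s) * \<zeta>"
      have u: "u \<in> ball z s" using mem[OF that] by (simp add: u_def)
      have "k u \<noteq> 0"
      proof
        assume "k u = 0"
        with k2[OF u] have "a = g u" using az by simp
        with a u show False by auto
      qed
      \<comment> \<open>Univalence enters here: the value 1 would force \<open>g u = g z\<close>,
        hence \<open>u = z\<close>, where \<open>k\<close> is -1.\<close>
      moreover have "k u \<noteq> 1"
      proof
        assume "k u = 1"
        with k2[OF u] have "g u = g z" using az by (simp add: field_simps)
        then have "u = z" using inj u zb by (auto dest: inj_onD)
        with \<open>k u = 1\<close> kz show False by simp
      qed
      ultimately show ?thesis by (simp add: F_def u_def)
    qed
    define \<zeta> where "\<zeta> = (w - z) / of_real (3/4 * s)"
    have w_eq: "z + of_real (3/4 * s) * \<zeta> = w"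
    proof -
      have "of_real (3/4 * s) \<noteq> (0::complex)" using s by simp
      then show ?thesis unfolding \<zeta>_def by (simp only: nonzero_mult_div_cancel_left times_divide_eq_right) simp
    qed
    have "norm \<zeta> = norm (w - z) / (3/4 * s)"
      unfolding \<zeta>_def norm_divide norm_of_real using s by simp
    also have "\<dots> \<le> (s/2) / (3/4 * s)" using w s by (intro divide_right_mono) auto
    also have "\<dots> = 2/3" using s by simp
    finally have \<zeta>: "norm \<zeta> \<le> 2/3" .
    have "norm (F 0) \<le> 1" by (simp add: F_def kz)
    from Schottky[OF holF this omit, of "2/3" \<zeta>] \<zeta> have "norm (F \<zeta>) \<le> K" by (simp add: K_def)
    then have "norm (k w) \<le> K" unfolding F_def w_eq .
    then have "norm (k w ^ 2) \<le> K^2" by (simp add: norm_power power_mono)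
    have "(g w - g z) / (a - g z) = 1 - k w ^ 2" using k2[OF wb] az by (simp add: field_simps)
    then have "norm (g w - g z) / norm (a - g z) \<le> 1 + norm (k w ^ 2)"
      by (metis norm_divide norm_one norm_triangle_ineq4)
    also have "\<dots> \<le> real N" using N \<open>norm (k w ^ 2) \<le> K^2\<close> by linarith
    finally show ?thesis using az by (simp add: divide_le_eq)
  qed
  then show ?thesis by blast
qed

section \<open>The Riemann sphere\<close>

lemma topspace_RS [simp]: "topspace RS = UNIV"
proof -
  have "openin RS UNIV" unfolding openin_RS sphere_open_def by simp
  then show ?thesis using openin_subset by blast
qed

lemma openin_RS_finite_part: "openin RS U \<Longrightarrow> open {z. Some z \<in> U}"
  by (simp add: openin_RS sphere_open_def)

lemma openin_RS_Some_image: "open S \<Longrightarrow> openin RS (Some ` S)"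
  by (auto simp: openin_RS sphere_open_def image_iff)

lemma Some_in_closure_of_RS: "Some x \<in> RS closure_of D \<longleftrightarrow> x \<in> closure {z. Some z \<in> D}"
proof
  assume L: "Some x \<in> RS closure_of D"
  show "x \<in> closure {z. Some z \<in> D}"
    unfolding closure_iff_nhds_not_empty
  proof (intro allI impI)
    fix A S assume "S \<subseteq> A" "x \<in> S" "open S"
    then have "\<exists>y. y \<in> D \<and> y \<in> Some ` S"
      using L openin_RS_Some_image[of S] unfolding in_closure_of by auto
    then show "{z. Some z \<in> D} \<inter> A \<noteq> {}" using \<open>S \<subseteq> A\<close> by auto
  qed
next
  assume R: "x \<in> closure {z. Some z \<in> D}"
  show "Some x \<in> RS closure_of D"
    unfolding in_closure_of
  proof (intro conjI allI impI)
    fix T assume "Some x \<in> T \<and> openin RS T"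
    then have "{z. Some z \<in> T} \<inter> {z. Some z \<in> D} \<noteq> {}"
      using R openin_RS_finite_part[of T] by (metis (mono_tags) open_Int_closure_eq_empty mem_Collect_eq IntI empty_iff)
    then show "\<exists>y. y \<in> D \<and> y \<in> T" by blast
  qed simp
qed

lemma Some_in_frontier_of_RS:
  assumes "openin RS D"
  shows "Some x \<in> RS frontier_of D \<longleftrightarrow> x \<in> closure {z. Some z \<in> D} \<and> Some x \<notin> D"
  using assms by (simp add: frontier_of_openin Some_in_closure_of_RS)

lemma closedin_RS_Some_image:
  assumes "compact K" shows "closedin RS (Some ` K)"
proof -
  obtain R where "\<forall>z\<in>K. norm z \<le> R" using compact_imp_bounded[OF assms] bounded_iff by blast
  then have "\<forall>z. R < norm z \<longrightarrow> Some z \<in> UNIV - Some ` K" by force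
  moreover have "{z. Some z \<in> UNIV - Some ` K} = - K" by auto
  ultimately show ?thesis
    unfolding closedin_def openin_RS sphere_open_def
    using compact_imp_closed[OF assms] by (auto simp: open_Compl)
qed

text \<open>Connectedness of the ball turns the failure of an inclusion into positive information
  about the boundary.\<close>

lemma ball_meets_frontier_RS:
  assumes "Some z \<in> D" "0 < s" "\<not> Some ` ball z s \<subseteq> D"
  shows "Some ` ball z s \<inter> RS frontier_of D \<noteq> {}"
proof (rule connectedin_Int_frontier_of)
  have "continuous_map euclidean RS Some"
    unfolding continuous_map_def using openin_RS_finite_part by auto
  then show "connectedin RS (Some ` ball z s)"
    by (rule connectedin_continuous_map_image) simp
  have "Some z \<in> Some ` ball z s \<inter> D" using assms by simp
  then show "Some ` ball z s \<inter> D \<noteq> {}" by blast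
qed (use assms in auto)

section \<open>Boundary behaviour of conformal maps\<close>

text \<open>Injectivity together with \<open>f None = None\<close> prevents a finite point from
  being sent to infinity, so \<open>the\<close> is never applied to \<open>None\<close> on the
  finite part of \<open>D\<close>.\<close>

lemma koebe_finite_part:
  fixes f :: "complex option \<Rightarrow> complex option"
  defines "g \<equiv> \<lambda>z. the (f (Some z))"
  assumes k: "koebe_normalized_conformal f D C" and D: "None \<in> D"
  shows "\<And>z. Some z \<in> D \<Longrightarrow> f (Some z) = Some (g z)"
    "inj_on g {z. Some z \<in> D}" "g ` {z. Some z \<in> D} = {w. Some w \<in> C}"
    "g holomorphic_on {z. Some z \<in> D}"
proof -
  have bij: "bij_betw f D C" and N: "f None = None"
    using k unfolding koebe_normalized_conformal_def by auto
  show *: "f (Some z) = Some (g z)" if "Some z \<in> D" for z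
  proof -
    have "f (Some z) \<noteq> None"
      using bij N D that by (metis bij_betw_imp_inj_on inj_on_eq_iff option.distinct(1))
    then show ?thesis by (simp add: g_def)
  qed
  show "inj_on g {z. Some z \<in> D}"
  proof (rule inj_onI)
    fix x y assume "x \<in> {z. Some z \<in> D}" "y \<in> {z. Some z \<in> D}" "g x = g y"
    then show "x = y" using * bij by (metis bij_betw_imp_inj_on inj_on_eq_iff mem_Collect_eq option.inject)
  qed
  show "g ` {z. Some z \<in> D} = {w. Some w \<in> C}"
  proof (intro equalityI subsetI)
    fix w assume "w \<in> g ` {z. Some z \<in> D}"
    then show "w \<in> {w. Some w \<in> C}" using * bij_betwE[OF bij] by force
  next
    fix w assume "w \<in> {w. Some w \<in> C}"
    then obtain u where u: "u \<in> D" "f u = Some w" using bij by (auto simp: bij_betw_def)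
    then obtain z where "u = Some z" using N by (cases u) auto
    then show "w \<in> g ` {z. Some z \<in> D}" using u by (intro image_eqI[of _ _ z]) (auto simp: g_def)
  qed
  show "g holomorphic_on {z. Some z \<in> D}"
    using k unfolding koebe_normalized_conformal_def g_def by auto
qed

text \<open>A solution of \<open>g z = w\<close> is a fixed point of \<open>z \<mapsto> w + z - g z\<close>.\<close>
lemma solvable_near_infinity:
  fixes g :: "complex \<Rightarrow> complex"
  assumes cont: "continuous_on S g" and S: "\<And>z. R\<^sub>0 < norm z \<Longrightarrow> z \<in> S"
    and g: "(\<lambda>z. g z - z) \<in> O[at_infinity](\<lambda>z. inverse z)"
  shows "\<exists>R'. \<forall>w. R' < norm w \<longrightarrow> (\<exists>z\<in>S. R < norm z \<and> g z = w)"
proof -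
  obtain c where c: "c > 0" "eventually (\<lambda>z. norm (g z - z) \<le> c * norm (inverse z)) at_infinity"
    using landau_o.bigE[OF g] by blast
  then obtain b where b: "\<And>z. b \<le> norm z \<Longrightarrow> norm (g z - z) \<le> c * norm (inverse z)"
    unfolding eventually_at_infinity by blast
  \<comment> \<open>Beyond \<open>B\<close> the function is defined, the error estimate is valid,
    and \<open>norm (inverse z)\<close> is at most 1, so the error is at most
    \<open>c\<close>.\<close>
  define B where "B = max (max 1 b) (max \<bar>R\<^sub>0\<bar> \<bar>R\<bar>)"
  have B: "1 \<le> B" "b \<le> B" "R\<^sub>0 \<le> B" "R \<le> B" unfolding B_def by auto
  have small: "norm (g z - z) \<le> c" if "B < norm z" for z
  proof -
    have "norm (g z - z) \<le> c * norm (inverse z)" using b[of z] B that by simp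
    also have "norm (inverse z) \<le> 1" using B that by (simp add: norm_inverse inverse_le_1_iff)
    then have "c * norm (inverse z) \<le> c * 1" using c by (intro mult_left_mono) auto
    finally show ?thesis by simp
  qed
  show ?thesis
  \<comment> \<open>For such \<open>w\<close> the closed disk of radius \<open>c\<close> about
    \<open>w\<close> stays beyond \<open>B\<close>, so the fixed-point map sends this disk into
    itself and Brouwer's theorem applies.\<close>
  proof (intro exI[of _ "B + c"] allI impI)
    fix w :: complex assume w: "B + c < norm w"
    have far: "B < norm z" if "z \<in> cball w c" for z
    proof -
      have "norm w \<le> norm z + dist w z" by (simp add: dist_norm) (metis norm_triangle_sub)
      then show ?thesis using w that by simp
    qed
    obtain z where z: "z \<in> cball w c" "w + z - g z = z"
    proof (rule brouwer[of "cball w c" "\<lambda>z. w + z - g z"])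
      show "continuous_on (cball w c) (\<lambda>z. w + z - g z)"
        by (intro continuous_intros continuous_on_subset[OF cont]) (use far S B in force)
      show "(\<lambda>z. w + z - g z) \<in> cball w c \<rightarrow> cball w c"
        using small far by (auto simp: dist_norm norm_minus_commute)
    qed (use c in auto)
    then show "\<exists>z\<in>S. R < norm z \<and> g z = w"
      using far[of z] S[of z] B by (intro bexI[of _ z]) (auto simp: algebra_simps)
  qed
qed

text \<open>All sufficiently large values of \<open>g\<close> are attained far from
  \<open>x\<close>, so by injectivity \<open>g\<close> is bounded near \<open>x\<close> and some
  sequence of values converges. Its limit is not attained: otherwise the open mapping theorem would
  cover a neighbourhood of it by values at points away from \<open>x\<close>, again against
  injectivity.\<close>

lemma koebe_frontier_limit:
  fixes f :: "complex option \<Rightarrow> complex option"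
  defines "g \<equiv> \<lambda>z. the (f (Some z))"
  assumes k: "koebe_normalized_conformal f D C" and D: "None \<in> D" "openin RS D" "openin RS C"
    and x: "Some x \<in> RS frontier_of D"
  shows "\<exists>a. Some a \<in> RS frontier_of C \<and>
    (\<forall>\<delta>>0. \<forall>\<epsilon>>0. \<exists>z. Some z \<in> D \<and> dist z x < \<delta> \<and> dist (g z) a < \<epsilon>)"
proof -
  define S where "S = {z. Some z \<in> D}"
  have S: "open S" unfolding S_def by (rule openin_RS_finite_part[OF D(2)])
  note fp = koebe_finite_part[OF k D(1), folded g_def S_def]
  have x': "x \<in> closure S" "x \<notin> S"
    using x Some_in_frontier_of_RS[OF D(2)] by (auto simp: S_def)
  then obtain u where u: "\<And>n. u n \<in> S" "u \<longlonglongrightarrow> x"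
    unfolding closure_sequential by blast
  obtain R\<^sub>0 where "\<And>z. R\<^sub>0 < norm z \<Longrightarrow> z \<in> S"
    using D(1,2) unfolding openin_RS sphere_open_def S_def by blast
  moreover have "(\<lambda>z. g z - z) \<in> O[at_infinity](\<lambda>z. inverse z)"
    using k unfolding koebe_normalized_conformal_def g_def by blast
  ultimately have "\<exists>R'. \<forall>w. R' < norm w \<longrightarrow> (\<exists>z\<in>S. norm x + 1 < norm z \<and> g z = w)"
    by (intro solvable_near_infinity holomorphic_on_imp_continuous_on fp) auto
  then obtain R' where R': "\<And>w. R' < norm w \<Longrightarrow> \<exists>z\<in>S. norm x + 1 < norm z \<and> g z = w" by blast
  have bd: "norm (g z) \<le> R'" if "z \<in> S" "norm z \<le> norm x + 1" for z
  proof (rule ccontr)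
    assume "\<not> ?thesis"
    then obtain z' where "z' \<in> S" "norm x + 1 < norm z'" "g z' = g z" using R'[of "g z"] by auto
    then show False using inj_onD[OF fp(2), of z' z] that by auto
  qed
  have "eventually (\<lambda>n. dist (u n) x < 1) sequentially"
    using u(2) by (rule tendstoD) simp
  then obtain n0 where n0: "\<And>n. n \<ge> n0 \<Longrightarrow> dist (u n) x < 1" unfolding eventually_sequentially by blast
  have "g (u (n + n0)) \<in> cball 0 R'" for n
  proof -
    have "norm (u (n + n0)) \<le> norm x + 1"
      using n0[of "n + n0"] norm_triangle_sub[of "u (n + n0)" x] by (simp add: dist_norm)
    then show ?thesis using bd u(1) by simp
  qed
  then obtain a r where a: "strict_mono r" "((\<lambda>n. g (u (n + n0))) \<circ> r) \<longlonglongrightarrow> a"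
    using compact_cball[of "0::complex" R', unfolded compact_def, rule_format, of "\<lambda>n. g (u (n + n0))"]
    by blast
  define v where "v n = u (r n + n0)" for n
  have v: "v n \<in> S" for n by (simp add: v_def u)
  have vx: "v \<longlonglongrightarrow> x"
    using LIMSEQ_subseq_LIMSEQ[OF LIMSEQ_ignore_initial_segment[OF u(2)] a(1), of n0] by (simp add: v_def[abs_def] comp_def)
  have va: "(\<lambda>n. g (v n)) \<longlonglongrightarrow> a" using a(2) by (simp add: v_def comp_def)
  have "a \<notin> g ` S"
  proof
    assume "a \<in> g ` S"
    then obtain y where y: "y \<in> S" "a = g y" by blast
    \<comment> \<open>The removed disk has half the distance to \<open>y\<close> as radius, so
      \<open>y\<close> stays in \<open>W\<close> while \<open>v n\<close> eventually leaves
      it.\<close>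
    define W where "W = S - cball x (dist x y / 2)"
    have xy: "dist x y > 0" using y x' by auto
    have "open W" unfolding W_def using S by (intro open_Diff) auto
    then have "open (g ` W)"
      by (intro open_mapping_thm3 holomorphic_on_subset[OF fp(4)] inj_on_subset[OF fp(2)]) (auto simp: W_def)
    moreover have "a \<in> g ` W" using y xy by (auto simp: W_def)
    ultimately have "eventually (\<lambda>n. g (v n) \<in> g ` W) sequentially"
      using va by (metis topological_tendstoD)
    moreover have "eventually (\<lambda>n. dist (v n) x < dist x y / 2) sequentially"
      using vx xy by (intro tendstoD) auto
    ultimately have "eventually (\<lambda>n. False) sequentially"
    proof eventually_elim
      case (elim n)
      then obtain z where z: "z \<in> W" "g (v n) = g z" by blast
      then have "v n = z" using inj_onD[OF fp(2)] v by (auto simp: W_def)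
      then show False using elim z by (auto simp: W_def dist_commute)
    qed
    then show False by simp
  qed
  moreover have "a \<in> closure (g ` S)"
    unfolding closure_sequential using va v by (intro exI[of _ "\<lambda>n. g (v n)"]) simp
  ultimately have "Some a \<in> RS frontier_of C"
    unfolding Some_in_frontier_of_RS[OF D(3)] fp(3) by simp
  moreover have "\<exists>z. Some z \<in> D \<and> dist z x < \<delta> \<and> dist (g z) a < \<epsilon>" if "\<delta> > 0" "\<epsilon> > 0" for \<delta> \<epsilon>
  proof -
    have "eventually (\<lambda>n. dist (v n) x < \<delta> \<and> dist (g (v n)) a < \<epsilon>) sequentially"
      using tendstoD[OF vx that(1)] tendstoD[OF va that(2)] by eventually_elim simp
    then obtain n where "dist (v n) x < \<delta> \<and> dist (g (v n)) a < \<epsilon>"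
      unfolding eventually_sequentially by blast
    then show ?thesis using v[of n] by (auto simp: S_def)
  qed
  ultimately show ?thesis by blast
qed

section \<open>Basic open sets\<close>

definition rectangle_code :: "nat \<Rightarrow> nat \<Rightarrow> nat \<Rightarrow> nat \<Rightarrow> nat" where
  "rectangle_code a b c d = 2 * pair (pair a b) (pair c d)"

text \<open>For nonnegative \<open>s\<close>, a condition in rational arithmetic ensuring that the
  open disk of radius \<open>s\<close> about the point lies in the basic set; for exteriors the
  norms are squared to avoid roots. At \<open>s = 0\<close> it amounts to membership together with
  validity of the code.\<close>

definition deep_inside :: "nat \<Rightarrow> real \<Rightarrow> real \<Rightarrow> real \<Rightarrow> bool" where
  "deep_inside n x y s \<longleftrightarrow>
    (\<exists>a b c d. n = rectangle_code a b c d \<and> rat_code a < x - s \<and> x + s < rat_code b \<and>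
       rat_code c < y - s \<and> y + s < rat_code d) \<or>
    (\<exists>r. n = Suc (2 * r) \<and> 0 < rat_code r \<and>
       (rat_code r + s) * (rat_code r + s) < x * x + y * y)"

lemma basic_rectangle_code:
  "basic (rectangle_code a b c d) =
    Some ` {z. rat_code a < Re z \<and> Re z < rat_code b \<and> rat_code c < Im z \<and> Im z < rat_code d}"
  "valid_code (rectangle_code a b c d) \<longleftrightarrow> rat_code a < rat_code b \<and> rat_code c < rat_code d"
  by (simp_all add: basic_def valid_code_def rect_params_def rectangle_code_def)

lemma basic_exterior_code:
  "basic (Suc (2 * r)) = insert None (Some ` {z. rat_code r < norm z})"
  "valid_code (Suc (2 * r)) \<longleftrightarrow> 0 < rat_code r"
  by (simp_all add: basic_def valid_code_def)

lemma code_cases: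
  obtains (rectangle) a b c d where "n = rectangle_code a b c d" | (exterior) r where "n = Suc (2 * r)"
proof (cases "even n")
  case True
  then have "n = rectangle_code (pfst (pfst (n div 2))) (psnd (pfst (n div 2)))
      (pfst (psnd (n div 2))) (psnd (psnd (n div 2)))"
    by (simp add: rectangle_code_def)
  then show ?thesis using that by blast
next
  case False
  then show ?thesis using that(2)[of "n div 2"] by simp
qed

lemma rectangle_code_inject:
  "rectangle_code a b c d = rectangle_code a' b' c' d' \<longleftrightarrow> a = a' \<and> b = b' \<and> c = c' \<and> d = d'"
  by (simp add: rectangle_code_def)

lemma rectangle_neq_exterior: "rectangle_code a b c d \<noteq> Suc (2 * r)"
  unfolding rectangle_code_def by presburger

lemma deep_inside_rectangle:
  "deep_inside (rectangle_code a b c d) x y s \<longleftrightarrow>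
    rat_code a < x - s \<and> x + s < rat_code b \<and> rat_code c < y - s \<and> y + s < rat_code d"
  using rectangle_neq_exterior by (auto simp: deep_inside_def rectangle_code_inject)

lemma deep_inside_exterior:
  "deep_inside (Suc (2 * r)) x y s \<longleftrightarrow> 0 < rat_code r \<and> (rat_code r + s) * (rat_code r + s) < x * x + y * y"
  using rectangle_neq_exterior[symmetric] by (auto simp: deep_inside_def)

lemma deep_inside_zero: "deep_inside n x y 0 \<longleftrightarrow> valid_code n \<and> Some (Complex x y) \<in> basic n"
proof (cases n rule: code_cases)
  case (rectangle a b c d)
  then show ?thesis by (auto simp: deep_inside_rectangle basic_rectangle_code)
next
  case (exterior r)
  show ?thesis
  proof (cases "0 < rat_code r")
    case True
    then have "rat_code r < sqrt (x * x + y * y) \<longleftrightarrow> rat_code r * rat_code r < x * x + y * y"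
      using real_less_rsqrt[of "rat_code r" "x * x + y * y"]
      by (metis less_eq_real_def linorder_not_less power2_eq_square real_sqrt_le_mono real_sqrt_unique)
    then show ?thesis using exterior True
      by (auto simp: deep_inside_exterior basic_exterior_code cmod_def power2_eq_square)
  qed (use exterior in \<open>auto simp: deep_inside_exterior basic_exterior_code\<close>)
qed

lemma deep_inside_ball:
  assumes "deep_inside n x y s" "0 \<le> s"
  shows "valid_code n" "Some ` ball (Complex x y) s \<subseteq> basic n"
proof -
  have "valid_code n \<and> Some ` ball (Complex x y) s \<subseteq> basic n"
  proof (cases n rule: code_cases)
    case (rectangle a b c d)
    have "\<bar>Re z - x\<bar> < s \<and> \<bar>Im z - y\<bar> < s" if "dist (Complex x y) z < s" for z
      using abs_Re_le_cmod[of "z - Complex x y"] abs_Im_le_cmod[of "z - Complex x y"] that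
      by (simp add: dist_norm norm_minus_commute)
    then show ?thesis using assms rectangle
      by (fastforce simp: deep_inside_rectangle basic_rectangle_code)
  next
    case (exterior r)
    then have r: "0 < rat_code r" "(rat_code r + s) * (rat_code r + s) < x * x + y * y"
      using assms by (auto simp: deep_inside_exterior)
    then have "rat_code r + s < norm (Complex x y)"
      unfolding cmod_def by (intro real_less_rsqrt) (simp add: power2_eq_square)
    moreover have "norm (Complex x y) \<le> norm z + dist (Complex x y) z" for z
      by (simp add: dist_norm) (metis norm_triangle_sub)
    ultimately have "rat_code r < norm z" if "dist (Complex x y) z < s" for z
      using that by (smt (verit))
    then show ?thesis using r exterior by (auto simp: basic_exterior_code)
  qed
  then show "valid_code n" "Some ` ball (Complex x y) s \<subseteq> basic n" by auto
qed

text \<open>Only strict inequalities between continuous functions of the point and of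
  \<open>s\<close> occur, so the condition is open.\<close>

lemma deep_inside_nearby:
  assumes "valid_code n" "Some z\<^sub>0 \<in> basic n"
  shows "\<exists>\<epsilon>>0. \<forall>z s. dist z z\<^sub>0 < \<epsilon> \<and> \<bar>s\<bar> < \<epsilon> \<longrightarrow> deep_inside n (Re z) (Im z) s"
proof -
  have "open {p. deep_inside n (Re (fst p)) (Im (fst p)) (snd p)}"
  proof (cases n rule: code_cases)
    case (rectangle a b c d)
    show ?thesis unfolding rectangle deep_inside_rectangle
      by (intro open_Collect_conj open_Collect_less continuous_intros)
  next
    case (exterior r)
    show ?thesis unfolding exterior deep_inside_exterior
      by (intro open_Collect_conj open_Collect_less continuous_intros)
  qed
  moreover have "(z\<^sub>0, 0) \<in> {p. deep_inside n (Re (fst p)) (Im (fst p)) (snd p)}"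
    using assms deep_inside_zero[of n "Re z\<^sub>0" "Im z\<^sub>0"] by simp
  ultimately obtain e where e: "e > 0" "ball (z\<^sub>0, 0) e \<subseteq> {p. deep_inside n (Re (fst p)) (Im (fst p)) (snd p)}"
    using openE by blast
  have "deep_inside n (Re z) (Im z) s" if "dist z z\<^sub>0 < e / 2" "\<bar>s\<bar> < e / 2" for z s
  proof -
    have "dist (z\<^sub>0, 0) (z, s) \<le> dist z\<^sub>0 z + dist 0 s"
      unfolding dist_Pair_Pair by (rule sqrt_sum_squares_le_sum) auto
    then have "(z, s) \<in> ball (z\<^sub>0, 0) e" using that by (simp add: dist_commute)
    then show ?thesis using e by auto
  qed
  then show ?thesis using e(1) by (intro exI[of _ "e / 2"]) auto
qed

lemma rational_point_dense:
  assumes "open S" "S \<noteq> {}"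
  shows "\<exists>x y. Complex (rat_code x) (rat_code y) \<in> S"
proof -
  obtain z where "z \<in> S" using assms by blast
  then obtain e where e: "e > 0" "ball z e \<subseteq> S" using assms(1) openE by blast
  obtain x where x: "Re z < rat_code x" "rat_code x < Re z + e / 2"
    using rat_code_dense[of "Re z" "Re z + e / 2"] e by auto
  obtain y where y: "Im z < rat_code y" "rat_code y < Im z + e / 2"
    using rat_code_dense[of "Im z" "Im z + e / 2"] e by auto
  have "norm (Complex (rat_code x) (rat_code y) - z) \<le>
      \<bar>Re (Complex (rat_code x) (rat_code y) - z)\<bar> + \<bar>Im (Complex (rat_code x) (rat_code y) - z)\<bar>"
    by (rule cmod_le)
  then have "dist z (Complex (rat_code x) (rat_code y)) < e" using x y by (simp add: dist_norm norm_minus_commute)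
  then show ?thesis using e by (intro exI[of _ x] exI[of _ y]) auto
qed

lemma small_rectangle:
  assumes "0 < \<epsilon>"
  shows "\<exists>a b c d. valid_code (rectangle_code a b c d) \<and> Some z \<in> basic (rectangle_code a b c d) \<and>
    Re z - \<epsilon> < rat_code a \<and> rat_code b < Re z + \<epsilon> \<and> Im z - \<epsilon> < rat_code c \<and> rat_code d < Im z + \<epsilon>"
proof -
  obtain a b c d where
    "Re z - \<epsilon> < rat_code a" "rat_code a < Re z" "Re z < rat_code b" "rat_code b < Re z + \<epsilon>"
    "Im z - \<epsilon> < rat_code c" "rat_code c < Im z" "Im z < rat_code d" "rat_code d < Im z + \<epsilon>"
    using rat_code_dense[of "Re z - \<epsilon>" "Re z"] rat_code_dense[of "Re z" "Re z + \<epsilon>"]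
      rat_code_dense[of "Im z - \<epsilon>" "Im z"] rat_code_dense[of "Im z" "Im z + \<epsilon>"] assms by auto
  then show ?thesis
    by (intro exI[of _ a] exI[of _ b] exI[of _ c] exI[of _ d]) (auto simp: basic_rectangle_code)
qed

text \<open>A listed set lies in its closure, hence in \<open>D\<close>. Conversely a small
  rectangle about the point fits into a closed disk inside \<open>D\<close>, and compactness makes
  that disk closed in the sphere.\<close>

lemma open_name_covers:
  assumes "open_name p D" "openin RS D"
  shows "Some z \<in> D \<longleftrightarrow> (\<exists>n k. p k = Suc n \<and> deep_inside n (Re z) (Im z) 0)"
proof
  assume "\<exists>n k. p k = Suc n \<and> deep_inside n (Re z) (Im z) 0"
  then obtain n where "n \<in> listed p" "Some z \<in> basic n"
    unfolding listed_def using deep_inside_zero[of _ "Re z" "Im z"] by auto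
  then show "Some z \<in> D"
    using assms(1) closure_of_subset[of "basic n" RS] unfolding open_name_def by auto
next
  assume "Some z \<in> D"
  then obtain e where e: "e > 0" "ball z e \<subseteq> {w. Some w \<in> D}"
    using openE[OF openin_RS_finite_part[OF assms(2)], of z] by auto
  obtain a b c d where r: "valid_code (rectangle_code a b c d)" "Some z \<in> basic (rectangle_code a b c d)"
    "Re z - e / 4 < rat_code a" "rat_code b < Re z + e / 4" "Im z - e / 4 < rat_code c" "rat_code d < Im z + e / 4"
    using small_rectangle[of "e / 4" z] e by auto
  \<comment> \<open>Each coordinate deviates by less than \<open>e / 4\<close>, and the two
    deviations add up to less than \<open>e / 2\<close>.\<close>
  let ?K = "cball z (e / 2)"
  have "basic (rectangle_code a b c d) \<subseteq> Some ` ?K"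
  proof -
    have "dist z w \<le> e / 2"
      if "rat_code a < Re w" "Re w < rat_code b" "rat_code c < Im w" "Im w < rat_code d" for w
    proof -
      have "norm (z - w) \<le> \<bar>Re (z - w)\<bar> + \<bar>Im (z - w)\<bar>" by (rule cmod_le)
      moreover have "\<bar>Re (z - w)\<bar> < e / 4" "\<bar>Im (z - w)\<bar> < e / 4"
        unfolding minus_complex.sel using r that by linarith+
      ultimately show ?thesis by (simp add: dist_norm)
    qed
    then show ?thesis by (auto simp: basic_rectangle_code)
  qed
  then have "RS closure_of (basic (rectangle_code a b c d)) \<subseteq> Some ` ?K"
    by (intro closure_of_minimal closedin_RS_Some_image) auto
  also have "\<dots> \<subseteq> D" using e by (auto simp: subset_iff)
  finally have "rectangle_code a b c d \<in> listed p"
    using assms(1) r unfolding open_name_def by auto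
  then show "\<exists>n k. p k = Suc n \<and> deep_inside n (Re z) (Im z) 0"
    unfolding listed_def using r deep_inside_zero[of _ "Re z" "Im z"] by auto
qed

lemma rational_computable_comp:
  assumes "rational_computable F" "computable G"
  shows "rational_computable (\<lambda>\<alpha> x. F \<alpha> (G \<alpha> x))"
proof -
  obtain A B C where F: "computable A" "computable B" "computable C"
    "F = (\<lambda>\<alpha> x. (real (A \<alpha> x) - real (B \<alpha> x)) / real (Suc (C \<alpha> x)))"
    using assms(1) by (rule rational_computableE)
  show ?thesis
    by (rule rational_computableI[OF computable_comp[OF F(1) assms(2)] computable_comp[OF F(2) assms(2)]
          computable_comp[OF F(3) assms(2)]]) (simp add: F(4))
qed

lemma computable_rectangle_code [computable_intros]:
  assumes "computable A" "computable B" "computable C" "computable D"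
  shows "computable (\<lambda>\<alpha> x. rectangle_code (A \<alpha> x) (B \<alpha> x) (C \<alpha> x) (D \<alpha> x))"
  unfolding rectangle_code_def by (intro computable_intros assms)

lemma semidecidable_deep_inside [semidecidable_intros]:
  assumes "computable N" "rational_computable X" "rational_computable Y" "rational_computable S"
  shows "semidecidable (\<lambda>\<alpha> x. deep_inside (N \<alpha> x) (X \<alpha> x) (Y \<alpha> x) (S \<alpha> x))"
  unfolding deep_inside_def
  by (intro semidecidable_intros rational_intros computable_intros computable_comp[OF assms(1)]
      rational_computable_comp[OF assms(2)] rational_computable_comp[OF assms(3)] rational_computable_comp[OF assms(4)])

section \<open>Certificates for meeting the boundary\<close>

lemma input5_simps:
  "input5 n e X p q 1 = e" "input5 n e X p q (5 * k + 2) = char_stream X k"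
  "input5 n e X p q (5 * k + 3) = p k" "input5 n e X p q (5 * k + 4) = q k"
proof -
  have "(1::nat) mod 5 = Suc 0" by simp
  then show "input5 n e X p q 1 = e" unfolding input5_def by (simp only: nat.case)
  have "(5 * k + 2) mod 5 = Suc (Suc 0)" "(5 * k + 3) mod 5 = Suc (Suc (Suc 0))"
    "(5 * k + 4) mod 5 = Suc (Suc (Suc (Suc 0)))" "(5 * k + 2) div 5 = k" "(5 * k + 3) div 5 = k"
    "(5 * k + 4) div 5 = k" by presburger+
  then show "input5 n e X p q (5 * k + 2) = char_stream X k" "input5 n e X p q (5 * k + 3) = p k"
    "input5 n e X p q (5 * k + 4) = q k"
    unfolding input5_def by (simp_all only: nat.case)
qed

text \<open>\<open>E \<alpha> x\<close> is meant to be a name of the rational point coded by \<open>x\<close>.\<close>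
definition simulation_oracle :: "((nat \<Rightarrow> nat) \<Rightarrow> nat \<Rightarrow> nat \<Rightarrow> nat) \<Rightarrow> (nat \<Rightarrow> nat) \<Rightarrow> nat \<Rightarrow> nat \<Rightarrow> nat" where
  "simulation_oracle E \<alpha> x k = (if k mod 2 = 0 then \<alpha> (5 * (k div 2) + 2) else E \<alpha> x (k div 2))"

text \<open>Position 1 of the tape holds the program code. The value \<open>Suc m\<close> at some
  output index means that the simulated name lists \<open>m\<close>.\<close>

definition value_in :: "((nat \<Rightarrow> nat) \<Rightarrow> nat \<Rightarrow> nat \<Rightarrow> nat) \<Rightarrow> (nat \<Rightarrow> nat) \<Rightarrow> nat \<Rightarrow> nat \<Rightarrow> bool" where
  "value_in E \<alpha> x m \<longleftrightarrow> (\<exists>k. derivable (eval_rule (simulation_oracle E \<alpha> x)) (verdict (\<alpha> 1) (lcons k 0) (Suc m)))"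

lemma semidecidable_value_in:
  assumes "computable (\<lambda>\<alpha> u. E \<alpha> (pfst u) (psnd u))" "computable X" "computable M"
  shows "semidecidable (\<lambda>\<alpha> u. value_in E \<alpha> (X \<alpha> u) (M \<alpha> u))"
proof -
  have "computable (\<lambda>\<alpha> u. simulation_oracle E \<alpha> (pfst u) (psnd u))"
    unfolding simulation_oracle_def
    by (intro computable_intros computable_comp2[OF assms(1)])
  note derivable = semidecidable_derivable[OF semidecidable_eval_rule[OF this]]
  show ?thesis unfolding value_in_def
    by (intro semidecidable_intros derivable computable_intros
        computable_comp[OF assms(2)] computable_comp[OF assms(3)])
qed

text \<open>Outside \<open>D\<close> the simulated program may diverge or write anything, so the
  equivalence is confined to points of \<open>D\<close>; a certificate therefore has to verify
  membership in \<open>D\<close> as well.\<close>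

lemma value_in_iff:
  assumes E: "\<forall>\<alpha> x y. listed (E \<alpha> (pair x y)) = {n. deep_inside n (rat_code x) (rat_code y) 0}"
    and f: "fun_name X M D f" and z: "Some (Complex (rat_code x) (rat_code y)) \<in> D"
  shows "value_in E (input5 n (code M) X p q) (pair x y) m \<longleftrightarrow>
    valid_code m \<and> f (Some (Complex (rat_code x) (rat_code y))) \<in> basic m"
proof -
  let ?\<alpha> = "input5 n (code M) X p q"
  let ?\<beta> = "simulation_oracle E (input5 n (code M) X p q) (pair x y)"
  have "point_name (E ?\<alpha> (pair x y)) (Some (Complex (rat_code x) (rat_code y)))"
    unfolding point_name_def E[rule_format] deep_inside_zero ..
  then obtain b where b: "computes (\<lambda>k. if even k then char_stream X (k div 2) else E ?\<alpha> (pair x y) (k div 2)) M b"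
    "point_name b (f (Some (Complex (rat_code x) (rat_code y))))"
    using f z unfolding fun_name_def by blast
  have "?\<beta> = (\<lambda>k. if even k then char_stream X (k div 2) else E ?\<alpha> (pair x y) (k div 2))"
    unfolding simulation_oracle_def input5_simps by (simp add: even_iff_mod_2_eq_zero)
  with b(1) have "eval ?\<beta> M [k] (b k)" for k unfolding computes_def by simp
  then have eval_eq: "eval ?\<beta> M [k] y \<longleftrightarrow> b k = y" for k y using eval_deterministic by blast
  have lcons: "lcons k 0 = list_encode [k]" for k by (simp add: lcons_def)
  have "value_in E (input5 n (code M) X p q) (pair x y) m \<longleftrightarrow> m \<in> listed b"
    unfolding value_in_def input5_simps lcons derivable_iff_eval eval_eq listed_def by simp
  then show ?thesis using b(2) unfolding point_name_def by simp
qed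

text \<open>The factor of \<open>N\<close> is half the perimeter of the first rectangle and so bounds its diameter.\<close>
definition separated :: "nat \<Rightarrow> nat \<Rightarrow> nat \<Rightarrow> nat \<Rightarrow> nat \<Rightarrow> nat \<Rightarrow> nat \<Rightarrow> nat \<Rightarrow> nat \<Rightarrow> bool" where
  "separated N a b c d a' b' c' d' \<longleftrightarrow>
    (let L = real N * (rat_code b - rat_code a + (rat_code d - rat_code c)) in
     rat_code b + L < rat_code a' \<or> rat_code b' + L < rat_code a \<or>
     rat_code d + L < rat_code c' \<or> rat_code d' + L < rat_code c)"

text \<open>With \<open>z\<close> and \<open>w\<close> the points coded by \<open>(x, y)\<close> and
  \<open>(x', y')\<close>, the inequality with factor 4 is the squared form of
  \<open>norm (w - z) < s / 2\<close>, where \<open>s\<close> is read as a rational. Tape positions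
  \<open>5 * k + 3\<close> and \<open>5 * k + 4\<close> carry the names of \<open>D\<close> and of
  the boundary of \<open>C\<close>; the first rectangle contains \<open>g z\<close> and meets that
  boundary, the second contains \<open>g w\<close>.\<close>

definition boundary_certificate :: "nat \<Rightarrow> ((nat \<Rightarrow> nat) \<Rightarrow> nat \<Rightarrow> nat \<Rightarrow> nat) \<Rightarrow> (nat \<Rightarrow> nat) \<Rightarrow> nat \<Rightarrow> bool" where
  "boundary_certificate N E \<alpha> n \<longleftrightarrow> (\<exists>x y x' y' s a b c d a' b' c' d'.
     0 < rat_code s \<and> deep_inside n (rat_code x) (rat_code y) (rat_code s) \<and>
     4 * ((rat_code x' - rat_code x) * (rat_code x' - rat_code x) +
          (rat_code y' - rat_code y) * (rat_code y' - rat_code y)) < rat_code s * rat_code s \<and>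
     (\<exists>m k. \<alpha> (5 * k + 3) = Suc m \<and> deep_inside m (rat_code x) (rat_code y) 0) \<and>
     (\<exists>m k. \<alpha> (5 * k + 3) = Suc m \<and> deep_inside m (rat_code x') (rat_code y') 0) \<and>
     (\<exists>k. \<alpha> (5 * k + 4) = Suc (rectangle_code a b c d)) \<and>
     value_in E \<alpha> (pair x y) (rectangle_code a b c d) \<and>
     value_in E \<alpha> (pair x' y') (rectangle_code a' b' c' d') \<and>
     separated N a b c d a' b' c' d')"

lemma semidecidable_boundary_certificate:
  assumes "computable (\<lambda>\<alpha> u. E \<alpha> (pfst u) (psnd u))"
  shows "semidecidable (\<lambda>\<alpha> n. boundary_certificate N E \<alpha> n)"
  unfolding boundary_certificate_def separated_def Let_def
  by (intro semidecidable_intros rational_intros computable_intros semidecidable_value_in[OF assms])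

lemma boundary_certificate_sound:
  assumes N: "\<forall>g z s a w. g holomorphic_on ball z s \<and> inj_on g (ball z s) \<and> a \<notin> g ` ball z s \<and>
      norm (w - z) < s / 2 \<longrightarrow> norm (g w - g z) \<le> real N * norm (a - g z)"
    and E: "\<forall>\<alpha> x y. listed (E \<alpha> (pair x y)) = {n. deep_inside n (rat_code x) (rat_code y) 0}"
    and D: "openin RS D" "None \<in> D" and C: "openin RS C" and k: "koebe_normalized_conformal f D C"
    and names: "open_name pD D" "fun_name X M D f" "closed_name pC (RS frontier_of C)"
    and cert: "boundary_certificate N E (input5 i (code M) X pD pC) n"
  shows "valid_code n \<and> basic n \<inter> RS frontier_of D \<noteq> {}"
proof -
  define g where "g = (\<lambda>z. the (f (Some z)))"
  note fp = koebe_finite_part[OF k D(2), folded g_def]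
  have f_eq: "f (Some z) = Some (g z)" if "Some z \<in> D" for z
    using fp(1)[OF that] by (simp add: g_def)
  from cert obtain x y x' y' s a b c d a' b' c' d' where
    s: "0 < rat_code s" and ins: "deep_inside n (rat_code x) (rat_code y) (rat_code s)" and
    near: "4 * ((rat_code x' - rat_code x) * (rat_code x' - rat_code x) +
          (rat_code y' - rat_code y) * (rat_code y' - rat_code y)) < rat_code s * rat_code s" and
    inD: "\<exists>m k. pD k = Suc m \<and> deep_inside m (rat_code x) (rat_code y) 0"
      "\<exists>m k. pD k = Suc m \<and> deep_inside m (rat_code x') (rat_code y') 0" and
    inC: "\<exists>k. pC k = Suc (rectangle_code a b c d)" and
    v: "value_in E (input5 i (code M) X pD pC) (pair x y) (rectangle_code a b c d)"
      "value_in E (input5 i (code M) X pD pC) (pair x' y') (rectangle_code a' b' c' d')" and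
    sep: "separated N a b c d a' b' c' d'"
    unfolding boundary_certificate_def input5_simps by blast
  define z w where "z = Complex (rat_code x) (rat_code y)" and "w = Complex (rat_code x') (rat_code y')"
  have zD: "Some z \<in> D" and wD: "Some w \<in> D"
    using inD open_name_covers[OF names(1) D(1), of z] open_name_covers[OF names(1) D(1), of w]
    by (auto simp: z_def w_def)
  have gz: "Some (g z) \<in> basic (rectangle_code a b c d)"
    using v(1) value_in_iff[OF E names(2), of x y] zD f_eq[OF zD] by (simp add: z_def)
  have gw: "Some (g w) \<in> basic (rectangle_code a' b' c' d')"
    using v(2) value_in_iff[OF E names(2), of x' y'] wD f_eq[OF wD] by (simp add: w_def)
  have "rectangle_code a b c d \<in> listed pC" using inC by (auto simp: listed_def)
  then obtain q where q: "q \<in> basic (rectangle_code a b c d)" "q \<in> RS frontier_of C"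
    using names(3) unfolding closed_name_def by auto
  then obtain q' where q': "q = Some q'" by (auto simp: basic_rectangle_code)
  have q'C: "Some q' \<notin> C" using q q' Some_in_frontier_of_RS[OF C] by auto
  have wz: "norm (w - z) < rat_code s / 2"
  proof -
    have "(norm (w - z))\<^sup>2 < (rat_code s / 2)\<^sup>2"
      using near unfolding cmod_power2 by (simp add: z_def w_def power2_eq_square)
    then show ?thesis by (rule power2_less_imp_less) (use s in simp)
  qed
  \<comment> \<open>If the disk were in \<open>D\<close>, the boundary point \<open>q'\<close> would
    be omitted by \<open>g\<close> there, and \<open>g w\<close> could be no further from
    \<open>g z\<close> than \<open>N\<close> times the half perimeter of their common rectangle for
    \<open>q'\<close> and \<open>g z\<close>, against separation.\<close>
  have "\<not> Some ` ball z (rat_code s) \<subseteq> D"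
  proof
    assume sub: "Some ` ball z (rat_code s) \<subseteq> D"
    then have "ball z (rat_code s) \<subseteq> {z. Some z \<in> D}" by auto
    moreover from this have "q' \<notin> g ` ball z (rat_code s)" using fp(3) q'C by blast
    ultimately have "norm (g w - g z) \<le> real N * norm (q' - g z)"
      using wz holomorphic_on_subset[OF fp(4)] inj_on_subset[OF fp(2)] by (intro N[rule_format]) auto
    moreover have "norm (q' - g z) \<le> rat_code b - rat_code a + (rat_code d - rat_code c)"
    proof -
      have "norm (q' - g z) \<le> \<bar>Re (q' - g z)\<bar> + \<bar>Im (q' - g z)\<bar>" by (rule cmod_le)
      moreover have "\<bar>Re (q' - g z)\<bar> \<le> rat_code b - rat_code a" "\<bar>Im (q' - g z)\<bar> \<le> rat_code d - rat_code c"
        using q(1) q' gz by (auto simp: basic_rectangle_code)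
      ultimately show ?thesis by linarith
    qed
    ultimately have "norm (g w - g z) \<le> real N * (rat_code b - rat_code a + (rat_code d - rat_code c))"
      by (meson mult_left_mono of_nat_0_le_iff order_trans)
    moreover have "\<bar>Re (g w - g z)\<bar> \<le> norm (g w - g z)" "\<bar>Im (g w - g z)\<bar> \<le> norm (g w - g z)"
      by (rule abs_Re_le_cmod abs_Im_le_cmod)+
    ultimately show False using sep gz gw unfolding separated_def Let_def basic_rectangle_code by auto
  qed
  then have "Some ` ball z (rat_code s) \<inter> RS frontier_of D \<noteq> {}"
    using ball_meets_frontier_RS zD s by blast
  then show ?thesis using deep_inside_ball[OF ins] s unfolding z_def by auto
qed

lemma rectangles_separated:
  assumes "p \<noteq> (q::complex)"
  shows "\<exists>a b c d a' b' c' d'. valid_code (rectangle_code a b c d) \<and> Some p \<in> basic (rectangle_code a b c d) \<and>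
    valid_code (rectangle_code a' b' c' d') \<and> Some q \<in> basic (rectangle_code a' b' c' d') \<and>
    separated N a b c d a' b' c' d'"
proof -
  \<comment> \<open>\<open>separated\<close> compares single coordinates, so the distance is
    measured in the maximum norm.\<close>
  define \<delta> where "\<delta> = max \<bar>Re p - Re q\<bar> \<bar>Im p - Im q\<bar>"
  have \<delta>: "\<delta> > 0" using assms unfolding \<delta>_def by (auto simp: complex_eq_iff less_max_iff_disj)
  \<comment> \<open>The first rectangle has half perimeter at most \<open>4 * \<epsilon>\<close>;
    the denominator leaves room for \<open>N\<close> times this plus the extents of both
    rectangles.\<close>
  define \<epsilon> where "\<epsilon> = \<delta> / (4 * real N + 4)"
  have pos: "4 * real N + 4 > 0" by simp
  have \<epsilon>: "\<epsilon> > 0" "(4 * real N + 4) * \<epsilon> = \<delta>" using \<delta> pos unfolding \<epsilon>_def by simp_all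
  obtain a b c d where r: "valid_code (rectangle_code a b c d)" "Some p \<in> basic (rectangle_code a b c d)"
    "Re p - \<epsilon> < rat_code a" "rat_code b < Re p + \<epsilon>" "Im p - \<epsilon> < rat_code c" "rat_code d < Im p + \<epsilon>"
    using small_rectangle[OF \<epsilon>(1), of p] by auto
  obtain a' b' c' d' where r': "valid_code (rectangle_code a' b' c' d')" "Some q \<in> basic (rectangle_code a' b' c' d')"
    "Re q - \<epsilon> < rat_code a'" "rat_code b' < Re q + \<epsilon>" "Im q - \<epsilon> < rat_code c'" "rat_code d' < Im q + \<epsilon>"
    using small_rectangle[OF \<epsilon>(1), of q] by auto
  define L where "L = real N * (rat_code b - rat_code a + (rat_code d - rat_code c))"
  have "rat_code b - rat_code a + (rat_code d - rat_code c) \<le> 4 * \<epsilon>" using r by linarith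
  then have "L \<le> real N * (4 * \<epsilon>)" unfolding L_def by (intro mult_left_mono) auto
  then have L: "L + 4 * \<epsilon> \<le> \<delta>" using \<epsilon>(2) by (simp add: algebra_simps)
  have "\<delta> = Re p - Re q \<or> \<delta> = Re q - Re p \<or> \<delta> = Im p - Im q \<or> \<delta> = Im q - Im p"
    unfolding \<delta>_def by linarith
  then have "separated N a b c d a' b' c' d'"
    unfolding separated_def L_def[symmetric] Let_def using r r' L \<epsilon>(1) by (elim disjE) linarith+
  then show ?thesis using r r' by blast
qed

text \<open>The order of choices matters: \<open>w\<close> is fixed near the boundary point
  \<open>t\<close>, the limit value \<open>q\<close> is then separated from \<open>g w\<close>, and
  only afterwards is \<open>z\<close> chosen near \<open>t\<close> with \<open>g z\<close> in the
  rectangle about \<open>q\<close>.\<close>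

lemma boundary_certificate_complete:
  assumes E: "\<forall>\<alpha> x y. listed (E \<alpha> (pair x y)) = {n. deep_inside n (rat_code x) (rat_code y) 0}"
    and D: "openin RS D" "None \<in> D" and C: "openin RS C" and k: "koebe_normalized_conformal f D C"
    and names: "open_name pD D" "fun_name X M D f" "closed_name pC (RS frontier_of C)"
    and n: "valid_code n" "basic n \<inter> RS frontier_of D \<noteq> {}"
  shows "boundary_certificate N E (input5 i (code M) X pD pC) n"
proof -
  define g where "g = (\<lambda>z. the (f (Some z)))"
  note fp = koebe_finite_part[OF k D(2), folded g_def]
  have f_eq: "f (Some z) = Some (g z)" if "Some z \<in> D" for z
    using fp(1)[OF that] by (simp add: g_def)
  have S: "open {z. Some z \<in> D}" by (rule openin_RS_finite_part[OF D(1)])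
  obtain u where u: "u \<in> basic n" "u \<in> RS frontier_of D" using n by blast
  \<comment> \<open>Infinity is an interior point of \<open>D\<close> and so not on its
    frontier.\<close>
  moreover have "u \<noteq> None" using u(2) D(2) frontier_of_openin[OF D(1)] by (metis DiffD2)
  ultimately obtain t where t: "Some t \<in> basic n" "Some t \<in> RS frontier_of D" by (cases u) auto
  obtain \<epsilon> where \<epsilon>: "\<epsilon> > 0" "\<And>z s. dist z t < \<epsilon> \<Longrightarrow> \<bar>s\<bar> < \<epsilon> \<Longrightarrow> deep_inside n (Re z) (Im z) s"
    using deep_inside_nearby[OF n(1) t(1)] by blast
  obtain s where s: "0 < rat_code s" "rat_code s < \<epsilon>" using rat_code_dense[OF \<epsilon>(1)] by auto
  have tc: "t \<in> closure {z. Some z \<in> D}" using t(2) Some_in_frontier_of_RS[OF D(1)] by auto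
  \<comment> \<open>Taking both points within a quarter of the radius from \<open>t\<close> puts
    them at distance less than half of it.\<close>
  have "{z. Some z \<in> D} \<inter> ball t (rat_code s / 4) \<noteq> {}"
    using tc[unfolded closure_approachable, rule_format, of "rat_code s / 4"] s by (auto simp: dist_commute)
  then obtain x' y' where w: "Complex (rat_code x') (rat_code y') \<in> {z. Some z \<in> D} \<inter> ball t (rat_code s / 4)"
    using rational_point_dense[of "{z. Some z \<in> D} \<inter> ball t (rat_code s / 4)"] S by auto
  define w where "w = Complex (rat_code x') (rat_code y')"
  have wD: "Some w \<in> D" "dist t w < rat_code s / 4" using w by (auto simp: w_def)
  obtain q where q: "Some q \<in> RS frontier_of C"
    "\<And>\<delta> \<epsilon>. \<delta> > 0 \<Longrightarrow> \<epsilon> > 0 \<Longrightarrow> \<exists>z. Some z \<in> D \<and> dist z t < \<delta> \<and> dist (g z) q < \<epsilon>"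
    using koebe_frontier_limit[OF k D(2,1) C t(2)] unfolding g_def by blast
  have "Some q \<notin> C" using q(1) Some_in_frontier_of_RS[OF C] by auto
  then have "q \<noteq> g w" using fp(3) wD(1) by blast
  then obtain a b c d a' b' c' d' where r: "valid_code (rectangle_code a b c d)" "Some q \<in> basic (rectangle_code a b c d)"
    "valid_code (rectangle_code a' b' c' d')" "Some (g w) \<in> basic (rectangle_code a' b' c' d')"
    "separated N a b c d a' b' c' d'"
    using rectangles_separated by blast
  define Q where "Q = {z. Some z \<in> basic (rectangle_code a b c d)}"
  have "Q = {z. rat_code a < Re z \<and> Re z < rat_code b \<and> rat_code c < Im z \<and> Im z < rat_code d}"
    by (auto simp: Q_def basic_rectangle_code)
  then have "open Q" by (auto intro!: open_Collect_conj open_Collect_less continuous_intros)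
  moreover have "q \<in> Q" using r by (simp add: Q_def)
  ultimately obtain e where e: "e > 0" "ball q e \<subseteq> Q" using openE by blast
  \<comment> \<open>Openness, from continuity of \<open>g\<close>, allows the point supplied by the
    limit argument to be replaced by a rational one.\<close>
  define V where "V = ({z. Some z \<in> D} \<inter> g -` Q) \<inter> ball t (rat_code s / 4)"
  have "open V" unfolding V_def
    by (intro open_Int open_ball continuous_open_preimage[OF holomorphic_on_imp_continuous_on[OF fp(4)] S \<open>open Q\<close>])
  moreover have "V \<noteq> {}"
  proof -
    obtain z where "Some z \<in> D" "dist z t < rat_code s / 4" "dist (g z) q < e"
      using q(2)[of "rat_code s / 4" e] s e by auto
    then have "z \<in> V" using e by (auto simp: V_def dist_commute subset_iff)
    then show ?thesis by blast
  qed
  ultimately obtain x y where z: "Complex (rat_code x) (rat_code y) \<in> V" using rational_point_dense by blast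
  define z where "z = Complex (rat_code x) (rat_code y)"
  have zD: "Some z \<in> D" "Some (g z) \<in> basic (rectangle_code a b c d)" "dist t z < rat_code s / 4"
    using z by (auto simp: V_def z_def Q_def)
  have "deep_inside n (Re z) (Im z) (rat_code s)"
    using zD(3) s by (intro \<epsilon>(2)) (auto simp: dist_commute)
  then have ins: "deep_inside n (rat_code x) (rat_code y) (rat_code s)" by (simp add: z_def)
  have "norm (w - z) \<le> dist t w + dist t z"
    by (metis dist_norm dist_commute dist_triangle)
  then have "norm (w - z) < rat_code s / 2" using wD zD by linarith
  then have "(norm (w - z))\<^sup>2 < (rat_code s / 2)\<^sup>2" by (intro power_strict_mono) auto
  from this[unfolded cmod_power2] have near: "4 * ((rat_code x' - rat_code x) * (rat_code x' - rat_code x) +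
          (rat_code y' - rat_code y) * (rat_code y' - rat_code y)) < rat_code s * rat_code s"
    by (simp add: z_def w_def power2_eq_square)
  have inD: "\<exists>m k. pD k = Suc m \<and> deep_inside m (rat_code x) (rat_code y) 0"
      "\<exists>m k. pD k = Suc m \<and> deep_inside m (rat_code x') (rat_code y') 0"
    using open_name_covers[OF names(1) D(1), of z] open_name_covers[OF names(1) D(1), of w] zD(1) wD(1)
    by (auto simp: z_def w_def)
  have "rectangle_code a b c d \<in> listed pC"
    using names(3) r(1,2) q(1) unfolding closed_name_def by auto
  then have inC: "\<exists>k. pC k = Suc (rectangle_code a b c d)" by (simp add: listed_def)
  have v: "value_in E (input5 i (code M) X pD pC) (pair x y) (rectangle_code a b c d)"
      "value_in E (input5 i (code M) X pD pC) (pair x' y') (rectangle_code a' b' c' d')"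
    using value_in_iff[OF E names(2), of x y] value_in_iff[OF E names(2), of x' y']
      zD f_eq[OF zD(1)] wD f_eq[OF wD(1)] r by (simp_all add: z_def w_def)
  show ?thesis unfolding boundary_certificate_def input5_simps
    using s(1) ins near inD inC v r(5) by blast
qed

theorem theorem8p4:
  shows "\<exists>U :: recf. \<forall>D f C.
    finitely_connected D \<and> non_degenerate D \<and> None \<in> D \<and> Some 0 \<notin> D \<and>
    circular_domain C \<and> koebe_normalized_conformal f D C \<longrightarrow>
    (\<forall>pD X M pC. open_name pD D \<and> fun_name X M D f \<and> closed_name pC (RS frontier_of C) \<longrightarrow>
       (\<exists>\<beta>. computes (input5 (card (boundary_components D)) (code M) X pD pC) U \<beta> \<and>
            closed_name \<beta> (RS frontier_of D)))"
proof -
  obtain N :: nat where N: "\<forall>g z s a w. g holomorphic_on ball z s \<and> inj_on g (ball z s) \<and> a \<notin> g ` ball z s \<and>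
      norm (w - z) < s / 2 \<longrightarrow> norm (g w - g z) \<le> real N * norm (a - g z)"
    using univalent_omitting_bound by blast
  \<comment> \<open>The simulated program must be fed with names of rational points; these are
    generated by enumerating the basic sets that contain the point.\<close>
  have "semidecidable (\<lambda>\<alpha> u. deep_inside (psnd u) (rat_code (pfst (pfst u))) (rat_code (psnd (pfst u))) 0)"
    by (intro semidecidable_intros rational_intros computable_intros)
  then obtain E where E: "computable (\<lambda>\<alpha> u. E \<alpha> (pfst u) (psnd u))"
    "\<And>\<alpha> x. listed (E \<alpha> x) = {n. deep_inside n (rat_code (pfst x)) (rat_code (psnd x)) 0}"
    by (rule semidecidable_enumerator[of "\<lambda>\<alpha> x n. deep_inside n (rat_code (pfst x)) (rat_code (psnd x)) 0"]) blast
  have E': "\<forall>\<alpha> x y. listed (E \<alpha> (pair x y)) = {n. deep_inside n (rat_code x) (rat_code y) 0}"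
    by (simp add: E(2))
  have "semidecidable (\<lambda>\<alpha> u. boundary_certificate N E \<alpha> (psnd u))"
    by (rule semidecidable_comp[OF semidecidable_boundary_certificate[OF E(1)]]) (intro computable_intros)
  then obtain B where B: "computable (\<lambda>\<alpha> u. B \<alpha> (pfst u) (psnd u))"
    "\<And>\<alpha> x. listed (B \<alpha> x) = {n. boundary_certificate N E \<alpha> n}"
    by (rule semidecidable_enumerator[of "\<lambda>\<alpha> x n. boundary_certificate N E \<alpha> n"]) blast
  \<comment> \<open>The set of certified codes is determined by the oracle alone, so the parameter
    of the enumerator is set to 0.\<close>
  have "computable (\<lambda>\<alpha> k. B \<alpha> 0 k)"
    by (rule computable_comp2[OF B(1)]) (intro computable_intros)+
  then obtain U where U: "\<And>\<alpha> k. eval \<alpha> U [k] (B \<alpha> 0 k)" unfolding computable_iff_recf by blast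
  show ?thesis
  proof (intro exI[of _ U] allI impI, elim conjE)
    fix D f C pD X M pC
    let ?\<alpha> = "input5 (card (boundary_components D)) (code M) X pD pC"
    assume "finitely_connected D" "None \<in> D" "circular_domain C" "koebe_normalized_conformal f D C"
      and names: "open_name pD D" "fun_name X M D f" "closed_name pC (RS frontier_of C)"
    then have DC: "openin RS D" "None \<in> D" "openin RS C" "koebe_normalized_conformal f D C"
      unfolding finitely_connected_def circular_domain_def domain_RS_def by auto
    have "boundary_certificate N E ?\<alpha> n \<longleftrightarrow> valid_code n \<and> basic n \<inter> RS frontier_of D \<noteq> {}" for n
      using boundary_certificate_sound[OF N E' DC names] boundary_certificate_complete[OF E' DC names]
      by blast
    then have "closed_name (B ?\<alpha> 0) (RS frontier_of D)" unfolding closed_name_def B(2) by (rule Collect_cong)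
    moreover have "computes ?\<alpha> U (B ?\<alpha> 0)" unfolding computes_def using U by blast
    ultimately show "\<exists>\<beta>. computes ?\<alpha> U \<beta> \<and> closed_name \<beta> (RS frontier_of D)" by blast
  qed
qed

end
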